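(* Let $(A,\mathcal H)$ be a commutative Hopf algebroid over $\Bbbk$ such that the set $A(\Bbbk)$ of $\Bbbk$-algebra maps $A\to\Bbbk$ is non-empty. Then (i) for a given point $x\in A(\Bbbk)$, the $\Bbbk$-vector space $$\mathscr L(\mathcal H)_x:=\{\delta\in\mathrm{Der}_\Bbbk^{\,s}(\mathcal H,\Bbbk_{x\varepsilon})\mid\delta\circ t=0\}$$ admits a structure of Lie algebra whose bracket is given by $$[\delta,\delta']:\mathcal H\longrightarrow\Bbbk_{x\varepsilon},\qquad u\longmapsto\delta(u_1)\delta'(u_2)-\delta'(u_1)\delta(u_2);$$ (ii) there is an isomorphism of Lie algebras given by $$\nabla:\mathscr L(\mathcal H)_x\longrightarrow\mathscr L(\mathcal H_x)=\mathrm{Der}_\Bbbk(\mathcal H_x,\Bbbk_{x\varepsilon}),\qquad\delta\longmapsto\big[1\otimes_Au\otimes_A1\mapsto\delta(u)\big].$$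
   Context: $\Bbbk$ is a field. A commutative Hopf algebroid $(A,\mathcal H)$ over $\Bbbk$ consists of commutative $\Bbbk$-algebras with algebra maps $s,t:A\to\mathcal H$, $\Delta:\mathcal H\to\mathcal H\otimes_A\mathcal H$ ($u\mapsto u_1\otimes_Au_2$), $\varepsilon:\mathcal H\to A$, $\mathcal S:\mathcal H\to\mathcal H$, where $\mathcal H$ is the $A$-bimodule ${}_s\mathcal H_t$ (left via $s$, right via $t$), $\Delta,\varepsilon$ are $A$-bilinear, coassociative and counital, $\mathcal Ss=t$, $\mathcal St=s$, $\mathcal S^2=\mathrm{id}$, $\mathcal S(h_1)h_2=t(\varepsilon(h))$, $h_1\mathcal S(h_2)=s(\varepsilon(h))$. For $x\in A(\Bbbk)$, $\Bbbk_x$ is $\Bbbk$ as an $A$-algebra via $x$, and $\Bbbk_{x\varepsilon}$ is $\Bbbk$ as an $\mathcal H$-module via the algebra map $x\circ\varepsilon$. $\mathrm{Der}_\Bbbk^{\,s}(\mathcal H,\Bbbk_{x\varepsilon})$ is the space of $\Bbbk$-linear $\delta:\mathcal H\to\Bbbk$ with $\delta(uv)=x(\varepsilon(u))\delta(v)+\delta(u)x(\varepsilon(v))$ and $\delta\circ s=0$. The isotropy Hopf algebra at $x$ is the commutative Hopf $\Bbbk$-algebra $\mathcal H_x=\Bbbk_x\otimes_A\mathcal H\otimes_A\Bbbk_x$ (left tensor via $s$, right tensor via $t$), with comultiplication $1\otimes_Au\otimes_A1\mapsto(1\otimes_Au_1\otimes_A1)\otimes_\Bbbk(1\otimes_Au_2\otimes_A1)$,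 counit $1\otimes_Au\otimes_A1\mapsto x(\varepsilon(u))$ and antipode induced by $\mathcal S$. Its Lie algebra $\mathrm{Der}_\Bbbk(\mathcal H_x,\Bbbk_{x\varepsilon})$ is the space of $\Bbbk$-derivations $\mathcal H_x\to\Bbbk$ with respect to the counit of $\mathcal H_x$, with bracket $[\gamma,\gamma'](h)=\gamma(h_1)\gamma'(h_2)-\gamma'(h_1)\gamma(h_2)$. *)

theory Defs
  imports
    "HOL-Algebra.Free_Abelian_Groups"
    "HOL-Algebra.Generated_Groups"
    "HOL-Algebra.Module"
begin

section \<open>Algebras and their tensor products\<close>

definition algebra_homs ::
    "('k, 'q) ring_scheme \<Rightarrow> ('k, 'b, 'm) module_scheme \<Rightarrow> ('k, 'c, 'n) module_scheme \<Rightarrow> ('b \<Rightarrow> 'c) set"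
  where "algebra_homs K B C =
    {f \<in> ring_hom B C. \<forall>c \<in> carrier K. \<forall>b \<in> carrier B. f (c \<odot>\<^bsub>B\<^esub> b) = c \<odot>\<^bsub>C\<^esub> f b}"

text \<open>A commutative ring \<open>B\<close> as an algebra over the source of a ring map \<open>f\<close> into \<open>B\<close>.\<close>

definition algebra_via :: "('b, 'm) ring_scheme \<Rightarrow> ('a \<Rightarrow> 'b) \<Rightarrow> ('a, 'b) module"
  where "algebra_via B f =
    \<lparr>carrier = carrier B, mult = mult B, one = one B, zero = zero B, add = add B,
     smult = (\<lambda>a b. f a \<otimes>\<^bsub>B\<^esub> b)\<rparr>"

text \<open>The tensor product of two modules over a commutative ring \<open>R\<close> is the free abelian group on
  pairs modulo the subgroup generated by the relations of bilinearity; its elements are cosets.\<close>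

type_synonym ('m, 'n) tensor = "(('m \<times> 'n) \<Rightarrow>\<^sub>0 int) set"

definition tensor_relations ::
    "('r, 'q) ring_scheme \<Rightarrow> ('r, 'm, 'x) module_scheme \<Rightarrow> ('r, 'n, 'y) module_scheme
      \<Rightarrow> (('m \<times> 'n) \<Rightarrow>\<^sub>0 int) set"
  where "tensor_relations R M N =
      {frag_of (m \<oplus>\<^bsub>M\<^esub> m', n) - (frag_of (m, n) + frag_of (m', n)) | m m' n.
         m \<in> carrier M \<and> m' \<in> carrier M \<and> n \<in> carrier N}
    \<union> {frag_of (m, n \<oplus>\<^bsub>N\<^esub> n') - (frag_of (m, n) + frag_of (m, n')) | m n n'.
         m \<in> carrier M \<and> n \<in> carrier N \<and> n' \<in> carrier N}
    \<union> {frag_of (r \<odot>\<^bsub>M\<^esub> m, n) - frag_of (m, r \<odot>\<^bsub>N\<^esub> n) | r m n.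
         r \<in> carrier R \<and> m \<in> carrier M \<and> n \<in> carrier N}"

definition tensor_kernel ::
    "('r, 'q) ring_scheme \<Rightarrow> ('r, 'm, 'x) module_scheme \<Rightarrow> ('r, 'n, 'y) module_scheme
      \<Rightarrow> ('m, 'n) tensor"
  where "tensor_kernel R M N =
    generate (free_Abelian_group (carrier M \<times> carrier N)) (tensor_relations R M N)"

text \<open>The underlying abelian group, written multiplicatively.\<close>

definition tensor_group ::
    "('r, 'q) ring_scheme \<Rightarrow> ('r, 'm, 'x) module_scheme \<Rightarrow> ('r, 'n, 'y) module_scheme
      \<Rightarrow> ('m, 'n) tensor monoid"
  where "tensor_group R M N =
    free_Abelian_group (carrier M \<times> carrier N) Mod tensor_kernel R M N"

definition pure_tensor ::
    "('r, 'q) ring_scheme \<Rightarrow> ('r, 'm, 'x) module_scheme \<Rightarrow> ('r, 'n, 'y) module_scheme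
      \<Rightarrow> 'm \<Rightarrow> 'n \<Rightarrow> ('m, 'n) tensor"
  where "pure_tensor R M N m n =
    tensor_kernel R M N #>\<^bsub>free_Abelian_group (carrier M \<times> carrier N)\<^esub> frag_of (m, n)"

text \<open>\<open>tensor_lift G f\<close> is the additive map with values in the (multiplicatively written) abelian
  group \<open>G\<close> that sends \<open>m \<otimes> n\<close> to \<open>f m n\<close>. It is meaningful if \<open>f\<close> is balanced, because then all
  representatives of a coset have the same image; see \<open>tensor_lift_hom\<close> and
  \<open>tensor_lift_pure\<close> below. If \<open>X = \<Delta> u\<close>, then \<open>tensor_lift G f X\<close> is what Sweedler notation
  writes as \<open>f u\<^sub>1 u\<^sub>2\<close>.\<close>

definition frag_eval :: "('g, 'z) monoid_scheme \<Rightarrow> ('m \<Rightarrow> 'n \<Rightarrow> 'g) \<Rightarrow> (('m \<times> 'n) \<Rightarrow>\<^sub>0 int) \<Rightarrow> 'g"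
  where "frag_eval G f F =
    (\<Otimes>\<^bsub>G\<^esub>p \<in> Poly_Mapping.keys F. f (fst p) (snd p) [^]\<^bsub>G\<^esub> Poly_Mapping.lookup F p)"

definition tensor_lift :: "('g, 'z) monoid_scheme \<Rightarrow> ('m \<Rightarrow> 'n \<Rightarrow> 'g) \<Rightarrow> ('m, 'n) tensor \<Rightarrow> 'g"
  where "tensor_lift G f X = the_elem (frag_eval G f ` X)"

definition balanced ::
    "('r, 'q) ring_scheme \<Rightarrow> ('r, 'm, 'x) module_scheme \<Rightarrow> ('r, 'n, 'y) module_scheme
      \<Rightarrow> ('g, 'z) monoid_scheme \<Rightarrow> ('m \<Rightarrow> 'n \<Rightarrow> 'g) \<Rightarrow> bool"
  where "balanced R M N G f \<longleftrightarrow>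
      (\<forall>m \<in> carrier M. \<forall>n \<in> carrier N. f m n \<in> carrier G)
    \<and> (\<forall>m \<in> carrier M. \<forall>m' \<in> carrier M. \<forall>n \<in> carrier N.
         f (m \<oplus>\<^bsub>M\<^esub> m') n = f m n \<otimes>\<^bsub>G\<^esub> f m' n)
    \<and> (\<forall>m \<in> carrier M. \<forall>n \<in> carrier N. \<forall>n' \<in> carrier N.
         f m (n \<oplus>\<^bsub>N\<^esub> n') = f m n \<otimes>\<^bsub>G\<^esub> f m n')
    \<and> (\<forall>r \<in> carrier R. \<forall>m \<in> carrier M. \<forall>n \<in> carrier N.
         f (r \<odot>\<^bsub>M\<^esub> m) n = f m (r \<odot>\<^bsub>N\<^esub> n))"

lemma frag_eval_hom:
  fixes G (structure)
  assumes G: "comm_group G" and f: "\<And>m n. (m, n) \<in> S \<Longrightarrow> f m n \<in> carrier G"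
  shows "frag_eval G f \<in> hom (free_Abelian_group S) G"
proof -
  interpret comm_group G by (rule G)
  define g where "g = (\<lambda>p. f (fst p) (snd p))"
  have g: "g p \<in> carrier G" if "p \<in> S" for p
    using f that by (cases p) (auto simp: g_def)
  have expand: "frag_eval G f F = finprod G (\<lambda>p. g p [^] Poly_Mapping.lookup F p) T"
    if "finite T" "Poly_Mapping.keys F \<subseteq> T" "T \<subseteq> S" for F T
    unfolding frag_eval_def
    using that g
    by (intro finprod_mono_neutral_cong_left) (auto simp: in_keys_iff g_def)
  show ?thesis
  proof (rule homI)
    fix F assume "F \<in> carrier (free_Abelian_group S)"
    then show "frag_eval G f F \<in> carrier G"
      using g by (subst expand[of "Poly_Mapping.keys F"]) (auto intro!: finprod_closed)
  next
    fix F F' assume "F \<in> carrier (free_Abelian_group S)" "F' \<in> carrier (free_Abelian_group S)"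
    then have *: "Poly_Mapping.keys F \<subseteq> S" "Poly_Mapping.keys F' \<subseteq> S" by auto
    define T where "T = Poly_Mapping.keys F \<union> Poly_Mapping.keys F'"
    have T: "finite T" "T \<subseteq> S" "Poly_Mapping.keys F \<subseteq> T" "Poly_Mapping.keys F' \<subseteq> T"
      "Poly_Mapping.keys (F + F') \<subseteq> T"
      using * keys_add[of F F'] by (auto simp: T_def)
    have gT: "g p \<in> carrier G" if "p \<in> T" for p
      using T(2) g that by blast
    have "frag_eval G f (F + F') = finprod G (\<lambda>p. g p [^] Poly_Mapping.lookup (F + F') p) T"
      by (rule expand[OF T(1,5,2)])
    also have "\<dots> = finprod G (\<lambda>p. g p [^] Poly_Mapping.lookup F p \<otimes> g p [^] Poly_Mapping.lookup F' p) T"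
      using gT by (intro finprod_cong') (auto simp: Poly_Mapping.lookup_add int_pow_mult)
    also have "\<dots> = finprod G (\<lambda>p. g p [^] Poly_Mapping.lookup F p) T
        \<otimes> finprod G (\<lambda>p. g p [^] Poly_Mapping.lookup F' p) T"
      using gT by (intro finprod_multf) auto
    also have "\<dots> = frag_eval G f F \<otimes> frag_eval G f F'"
      by (simp only: expand[OF T(1,3,2)] expand[OF T(1,4,2)])
    finally show "frag_eval G f (F \<otimes>\<^bsub>free_Abelian_group S\<^esub> F') = frag_eval G f F \<otimes> frag_eval G f F'"
      by simp
  qed
qed

lemma frag_eval_frag_of:
  assumes "comm_group G" "f m n \<in> carrier G"
  shows "frag_eval G f (frag_of (m, n)) = f m n"
proof -
  interpret comm_group G by fact
  have "Poly_Mapping.keys (frag_of (m, n)) = {(m, n)}"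
    by (rule keys_frag_of)
  then show ?thesis
    using assms by (simp add: frag_eval_def)
qed

lemma tensor_relations_subset:
  assumes "abelian_group M" "abelian_group N"
    and "\<forall>r \<in> carrier R. \<forall>m \<in> carrier M. r \<odot>\<^bsub>M\<^esub> m \<in> carrier M"
    and "\<forall>r \<in> carrier R. \<forall>n \<in> carrier N. r \<odot>\<^bsub>N\<^esub> n \<in> carrier N"
  shows "tensor_relations R M N \<subseteq> carrier (free_Abelian_group (carrier M \<times> carrier N))"
proof -
  let ?F = "free_Abelian_group (carrier M \<times> carrier N)"
  interpret M: abelian_group M by fact
  interpret N: abelian_group N by fact
  have of: "frag_of p \<in> carrier ?F" if "p \<in> carrier M \<times> carrier N" for p
    using that by simp
  have add: "x + y \<in> carrier ?F" if "x \<in> carrier ?F" "y \<in> carrier ?F" for x y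
    using that keys_add[of x y] by auto
  have diff: "x - y \<in> carrier ?F" if "x \<in> carrier ?F" "y \<in> carrier ?F" for x y
    using that keys_diff[of x y] by auto
  show ?thesis
    unfolding tensor_relations_def
    by (intro Un_least subsetI; elim CollectE exE conjE; hypsubst; intro diff add of)
       (auto simp: assms)
qed

lemma frag_eval_kernel:
  assumes "comm_group G" "abelian_group M" "abelian_group N"
    and "\<forall>r \<in> carrier R. \<forall>m \<in> carrier M. r \<odot>\<^bsub>M\<^esub> m \<in> carrier M"
    and "\<forall>r \<in> carrier R. \<forall>n \<in> carrier N. r \<odot>\<^bsub>N\<^esub> n \<in> carrier N"
    and f: "balanced R M N G f"
    and F: "F \<in> tensor_kernel R M N"
  shows "frag_eval G f F = \<one>\<^bsub>G\<^esub>"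
proof -
  let ?F = "free_Abelian_group (carrier M \<times> carrier N)"
  interpret G: comm_group G by fact
  interpret M: abelian_group M by fact
  interpret N: abelian_group N by fact
  have hom: "frag_eval G f \<in> hom ?F G"
    using f by (intro frag_eval_hom \<open>comm_group G\<close>) (auto simp: balanced_def)
  interpret h: group_hom ?F G "frag_eval G f"
    by (simp add: group_hom_def group_hom_axioms_def hom)
  have of: "frag_of (m, n) \<in> carrier ?F" if "m \<in> carrier M" "n \<in> carrier N" for m n
    using that by simp
  have ev: "frag_eval G f (frag_of (m, n)) = f m n" if "m \<in> carrier M" "n \<in> carrier N" for m n
    using f that by (intro frag_eval_frag_of \<open>comm_group G\<close>) (auto simp: balanced_def)
  have plus: "frag_eval G f (x + y) = frag_eval G f x \<otimes>\<^bsub>G\<^esub> frag_eval G f y"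
    if "x \<in> carrier ?F" "y \<in> carrier ?F" for x y
    using h.hom_mult[OF that] by simp
  have closed: "x + y \<in> carrier ?F" if "x \<in> carrier ?F" "y \<in> carrier ?F" for x y
    using that keys_add[of x y] by auto
  have minus: "frag_eval G f (x - y) = \<one>\<^bsub>G\<^esub>"
    if "x \<in> carrier ?F" "y \<in> carrier ?F" "frag_eval G f x = frag_eval G f y" for x y
  proof -
    have d: "x - y \<in> carrier ?F" using that(1,2) keys_diff[of x y] by auto
    have "frag_eval G f (x - y) \<otimes>\<^bsub>G\<^esub> frag_eval G f y = frag_eval G f y"
      using plus[OF d that(2)] that(3) by simp
    then show ?thesis
      using h.hom_closed[OF d] h.hom_closed[OF that(2)] by (simp only: G.r_cancel_one)
  qed
  note fD = f[unfolded balanced_def]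
  have ker: "frag_eval G f z = \<one>\<^bsub>G\<^esub>" if "z \<in> tensor_relations R M N" for z
    using that unfolding tensor_relations_def
  proof (elim UnE CollectE exE conjE)
    fix m m' n assume *: "z = frag_of (m \<oplus>\<^bsub>M\<^esub> m', n) - (frag_of (m, n) + frag_of (m', n))"
      "m \<in> carrier M" "m' \<in> carrier M" "n \<in> carrier N"
    show ?thesis unfolding *(1)
      by (rule minus[OF of closed[OF of of]])
         (use * fD in \<open>simp_all only: plus of ev M.a_closed\<close>)
  next
    fix m n n' assume *: "z = frag_of (m, n \<oplus>\<^bsub>N\<^esub> n') - (frag_of (m, n) + frag_of (m, n'))"
      "m \<in> carrier M" "n \<in> carrier N" "n' \<in> carrier N"
    show ?thesis unfolding *(1)
      by (rule minus[OF of closed[OF of of]])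
         (use * fD in \<open>simp_all only: plus of ev N.a_closed\<close>)
  next
    fix r m n assume *: "z = frag_of (r \<odot>\<^bsub>M\<^esub> m, n) - frag_of (m, r \<odot>\<^bsub>N\<^esub> n)"
      "r \<in> carrier R" "m \<in> carrier M" "n \<in> carrier N"
    show ?thesis unfolding *(1)
      by (rule minus[OF of of]) (use * fD in \<open>simp_all only: ev assms(4,5)[rule_format]\<close>)
  qed
  have "tensor_relations R M N \<subseteq> kernel ?F G (frag_eval G f)"
    using ker tensor_relations_subset[OF assms(2-5)] unfolding kernel_def by blast
  then have "tensor_kernel R M N \<subseteq> kernel ?F G (frag_eval G f)"
    unfolding tensor_kernel_def
    by (rule h.generate_subgroup_incl[OF _ h.subgroup_kernel])
  with F show ?thesis by (auto simp: kernel_def)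
qed

lemma tensor_kernel_normal:
  assumes "abelian_group M" "abelian_group N"
    and "\<forall>r \<in> carrier R. \<forall>m \<in> carrier M. r \<odot>\<^bsub>M\<^esub> m \<in> carrier M"
    and "\<forall>r \<in> carrier R. \<forall>n \<in> carrier N. r \<odot>\<^bsub>N\<^esub> n \<in> carrier N"
  shows "tensor_kernel R M N \<lhd> free_Abelian_group (carrier M \<times> carrier N)"
  unfolding tensor_kernel_def
  by (intro comm_group.normal_iff_subgroup[THEN iffD2] abelian_free_Abelian_group
      group.generate_is_subgroup group_free_Abelian_group tensor_relations_subset assms)

lemma tensor_lift_coset:
  assumes "comm_group G" "abelian_group M" "abelian_group N"
    and "\<forall>r \<in> carrier R. \<forall>m \<in> carrier M. r \<odot>\<^bsub>M\<^esub> m \<in> carrier M"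
    and "\<forall>r \<in> carrier R. \<forall>n \<in> carrier N. r \<odot>\<^bsub>N\<^esub> n \<in> carrier N"
    and f: "balanced R M N G f"
    and F: "F \<in> carrier (free_Abelian_group (carrier M \<times> carrier N))"
  shows "tensor_lift G f (tensor_kernel R M N #>\<^bsub>free_Abelian_group (carrier M \<times> carrier N)\<^esub> F)
    = frag_eval G f F"
proof -
  let ?F = "free_Abelian_group (carrier M \<times> carrier N)" and ?N = "tensor_kernel R M N"
  interpret G: comm_group G by fact
  interpret N: normal ?N ?F by (rule tensor_kernel_normal[OF assms(2-5)])
  have hom: "frag_eval G f \<in> hom ?F G"
    using f by (intro frag_eval_hom \<open>comm_group G\<close>) (auto simp: balanced_def)
  have *: "frag_eval G f (k \<otimes>\<^bsub>?F\<^esub> F) = frag_eval G f F" if "k \<in> ?N" for k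
  proof -
    have "k \<in> carrier ?F" using N.subset that by blast
    then have "frag_eval G f (k \<otimes>\<^bsub>?F\<^esub> F) = frag_eval G f k \<otimes>\<^bsub>G\<^esub> frag_eval G f F"
      by (rule hom_mult[OF hom _ F])
    then show ?thesis
      using frag_eval_kernel[OF assms(1-6) that] hom_in_carrier[OF hom F] by (simp only: G.l_one)
  qed
  have "frag_eval G f ` (?N #>\<^bsub>?F\<^esub> F) = {frag_eval G f F}"
  proof (intro equalityI subsetI)
    fix y assume "y \<in> frag_eval G f ` (?N #>\<^bsub>?F\<^esub> F)"
    then show "y \<in> {frag_eval G f F}" using * unfolding r_coset_def by blast
  next
    fix y assume "y \<in> {frag_eval G f F}"
    then have "y = frag_eval G f (\<one>\<^bsub>?F\<^esub> \<otimes>\<^bsub>?F\<^esub> F)" using *[OF subgroup.one_closed[OF N.subgroup_axioms]] by simp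
    then show "y \<in> frag_eval G f ` (?N #>\<^bsub>?F\<^esub> F)"
      using subgroup.one_closed[OF N.subgroup_axioms] unfolding r_coset_def by blast
  qed
  then show ?thesis by (simp add: tensor_lift_def)
qed

lemma tensor_lift_pure:
  assumes "comm_group G" "abelian_group M" "abelian_group N"
    and "\<forall>r \<in> carrier R. \<forall>m \<in> carrier M. r \<odot>\<^bsub>M\<^esub> m \<in> carrier M"
    and "\<forall>r \<in> carrier R. \<forall>n \<in> carrier N. r \<odot>\<^bsub>N\<^esub> n \<in> carrier N"
    and f: "balanced R M N G f"
    and "m \<in> carrier M" "n \<in> carrier N"
  shows "tensor_lift G f (pure_tensor R M N m n) = f m n"
  using assms unfolding pure_tensor_def
  by (subst tensor_lift_coset) (auto simp: balanced_def intro!: frag_eval_frag_of)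

lemma tensor_lift_hom:
  assumes "comm_group G" "abelian_group M" "abelian_group N"
    and "\<forall>r \<in> carrier R. \<forall>m \<in> carrier M. r \<odot>\<^bsub>M\<^esub> m \<in> carrier M"
    and "\<forall>r \<in> carrier R. \<forall>n \<in> carrier N. r \<odot>\<^bsub>N\<^esub> n \<in> carrier N"
    and f: "balanced R M N G f"
  shows "tensor_lift G f \<in> hom (tensor_group R M N) G"
proof -
  let ?F = "free_Abelian_group (carrier M \<times> carrier N)" and ?N = "tensor_kernel R M N"
  interpret N: normal ?N ?F by (rule tensor_kernel_normal[OF assms(2-5)])
  have hom: "frag_eval G f \<in> hom ?F G"
    using f by (intro frag_eval_hom \<open>comm_group G\<close>) (auto simp: balanced_def)
  note coset = tensor_lift_coset[OF assms(1-6)]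
  show ?thesis
  proof (rule homI)
    fix Y assume "Y \<in> carrier (tensor_group R M N)"
    then obtain F where F: "F \<in> carrier ?F" "Y = ?N #>\<^bsub>?F\<^esub> F"
      by (auto simp: tensor_group_def FactGroup_def RCOSETS_def)
    show "tensor_lift G f Y \<in> carrier G"
      unfolding F(2) coset[OF F(1)] by (rule hom_in_carrier[OF hom F(1)])
  next
    fix Y Z assume "Y \<in> carrier (tensor_group R M N)" "Z \<in> carrier (tensor_group R M N)"
    then obtain F F' where F: "F \<in> carrier ?F" "Y = ?N #>\<^bsub>?F\<^esub> F" "F' \<in> carrier ?F" "Z = ?N #>\<^bsub>?F\<^esub> F'"
      by (auto simp: tensor_group_def FactGroup_def RCOSETS_def)
    have "Y \<otimes>\<^bsub>tensor_group R M N\<^esub> Z = ?N #>\<^bsub>?F\<^esub> (F \<otimes>\<^bsub>?F\<^esub> F')"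
      unfolding F(2,4) tensor_group_def using N.rcos_sum[OF F(1,3)] by (simp add: FactGroup_def)
    then show "tensor_lift G f (Y \<otimes>\<^bsub>tensor_group R M N\<^esub> Z) = tensor_lift G f Y \<otimes>\<^bsub>G\<^esub> tensor_lift G f Z"
      unfolding F(2,4) using coset N.m_closed[OF F(1,3)] F(1,3) hom_mult[OF hom F(1,3)] by metis
  qed
qed

text \<open>The tensor product of two commutative \<open>R\<close>-algebras, as a commutative \<open>R\<close>-algebra.\<close>

definition tensor_algebra ::
    "('r, 'q) ring_scheme \<Rightarrow> ('r, 'm, 'x) module_scheme \<Rightarrow> ('r, 'n, 'y) module_scheme
      \<Rightarrow> ('r, ('m, 'n) tensor) module"
  where "tensor_algebra R M N =
    (let T = tensor_group R M N; pure = pure_tensor R M N in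
     \<lparr>carrier = carrier T,
      mult = (\<lambda>X Y. tensor_lift T (\<lambda>m n. tensor_lift T (\<lambda>m' n'.
                pure (m \<otimes>\<^bsub>M\<^esub> m') (n \<otimes>\<^bsub>N\<^esub> n')) Y) X),
      one = pure \<one>\<^bsub>M\<^esub> \<one>\<^bsub>N\<^esub>,
      zero = one T,
      add = mult T,
      smult = (\<lambda>r. tensor_lift T (\<lambda>m n. pure (r \<odot>\<^bsub>M\<^esub> m) n))\<rparr>)"

section \<open>Commutative Hopf algebroids\<close>

record ('k, 'a, 'h) hopf_algebroid_data =
  Base :: "('k, 'a) module"
  Total :: "('k, 'h) module"
  source :: "'a \<Rightarrow> 'h"
  target :: "'a \<Rightarrow> 'h"
  comult :: "'h \<Rightarrow> ('h, 'h) tensor"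
  counit :: "'h \<Rightarrow> 'a"
  antipode :: "'h \<Rightarrow> 'h"

definition via_source :: "('k, 'a, 'h, 'z) hopf_algebroid_data_scheme \<Rightarrow> ('a, 'h) module"
  where "via_source X = algebra_via (Total X) (source X)"

definition via_target :: "('k, 'a, 'h, 'z) hopf_algebroid_data_scheme \<Rightarrow> ('a, 'h) module"
  where "via_target X = algebra_via (Total X) (target X)"

text \<open>\<open>H \<otimes>\<^sub>A H\<close>, where the left factor is a (right) module via \<open>t\<close>, the right factor via \<open>s\<close>.\<close>

definition tensor2 ::
    "('k, 'a, 'h, 'z) hopf_algebroid_data_scheme \<Rightarrow> ('a, ('h, 'h) tensor) module"
  where "tensor2 X = tensor_algebra (Base X) (via_target X) (via_source X)"

definition pure2 ::
    "('k, 'a, 'h, 'z) hopf_algebroid_data_scheme \<Rightarrow> 'h \<Rightarrow> 'h \<Rightarrow> ('h, 'h) tensor"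
  where "pure2 X = pure_tensor (Base X) (via_target X) (via_source X)"

text \<open>\<open>(H \<otimes>\<^sub>A H) \<otimes>\<^sub>A H\<close>, where \<open>A\<close> acts on the left factor through \<open>a \<mapsto> 1 \<otimes> t a\<close>.\<close>

definition tensor2_via_target ::
    "('k, 'a, 'h, 'z) hopf_algebroid_data_scheme \<Rightarrow> ('a, ('h, 'h) tensor) module"
  where "tensor2_via_target X =
    algebra_via (tensor2 X) (\<lambda>a. pure2 X \<one>\<^bsub>Total X\<^esub> (target X a))"

definition tensor3 ::
    "('k, 'a, 'h, 'z) hopf_algebroid_data_scheme \<Rightarrow> ('a, (('h, 'h) tensor, 'h) tensor) module"
  where "tensor3 X = tensor_algebra (Base X) (tensor2_via_target X) (via_source X)"

definition pure3 ::
    "('k, 'a, 'h, 'z) hopf_algebroid_data_scheme \<Rightarrow> ('h, 'h) tensor \<Rightarrow> 'h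
      \<Rightarrow> (('h, 'h) tensor, 'h) tensor"
  where "pure3 X = pure_tensor (Base X) (tensor2_via_target X) (via_source X)"

text \<open>In the coassociativity axiom, \<open>u\<^sub>1 \<otimes> (u\<^sub>2\<^sub>1 \<otimes> u\<^sub>2\<^sub>2)\<close> is rebracketed to
  \<open>(u\<^sub>1 \<otimes> u\<^sub>2\<^sub>1) \<otimes> u\<^sub>2\<^sub>2\<close>. In the counit axioms, \<open>H \<otimes>\<^sub>A A\<close> and \<open>A \<otimes>\<^sub>A H\<close> are identified with \<open>H\<close>.\<close>

locale hopf_algebroid =
  fixes K :: "('k, 'q) ring_scheme" and X :: "('k, 'a, 'h, 'z) hopf_algebroid_data_scheme"
  assumes field: "field K"
    and base_algebra: "algebra K (Base X)"
    and total_algebra: "algebra K (Total X)"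
    and source_hom: "source X \<in> algebra_homs K (Base X) (Total X)"
    and target_hom: "target X \<in> algebra_homs K (Base X) (Total X)"
    and comult_hom: "comult X \<in> algebra_homs K (Total X)
      (algebra_via (tensor2 X) (\<lambda>c. pure2 X (c \<odot>\<^bsub>Total X\<^esub> \<one>\<^bsub>Total X\<^esub>) \<one>\<^bsub>Total X\<^esub>))"
    and counit_hom: "counit X \<in> algebra_homs K (Total X) (Base X)"
    and antipode_hom: "antipode X \<in> algebra_homs K (Total X) (Total X)"
    and comult_bilinear: "\<lbrakk>a \<in> carrier (Base X); b \<in> carrier (Base X); h \<in> carrier (Total X)\<rbrakk> \<Longrightarrow>
      comult X (source X a \<otimes>\<^bsub>Total X\<^esub> h \<otimes>\<^bsub>Total X\<^esub> target X b)
        = pure2 X (source X a) \<one>\<^bsub>Total X\<^esub> \<otimes>\<^bsub>tensor2 X\<^esub> comult X h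
            \<otimes>\<^bsub>tensor2 X\<^esub> pure2 X \<one>\<^bsub>Total X\<^esub> (target X b)"
    and counit_bilinear: "\<lbrakk>a \<in> carrier (Base X); b \<in> carrier (Base X); h \<in> carrier (Total X)\<rbrakk> \<Longrightarrow>
      counit X (source X a \<otimes>\<^bsub>Total X\<^esub> h \<otimes>\<^bsub>Total X\<^esub> target X b)
        = a \<otimes>\<^bsub>Base X\<^esub> counit X h \<otimes>\<^bsub>Base X\<^esub> b"
    and coassoc: "h \<in> carrier (Total X) \<Longrightarrow>
      tensor_lift (add_monoid (tensor3 X)) (\<lambda>u v. pure3 X (comult X u) v) (comult X h)
      = tensor_lift (add_monoid (tensor3 X)) (\<lambda>u v.
          tensor_lift (add_monoid (tensor3 X)) (\<lambda>v\<^sub>1 v\<^sub>2. pure3 X (pure2 X u v\<^sub>1) v\<^sub>2) (comult X v))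
          (comult X h)"
    and counit_right: "h \<in> carrier (Total X) \<Longrightarrow>
      tensor_lift (add_monoid (Total X))
        (\<lambda>u v. u \<otimes>\<^bsub>Total X\<^esub> target X (counit X v)) (comult X h) = h"
    and counit_left: "h \<in> carrier (Total X) \<Longrightarrow>
      tensor_lift (add_monoid (Total X))
        (\<lambda>u v. source X (counit X u) \<otimes>\<^bsub>Total X\<^esub> v) (comult X h) = h"
    and antipode_source: "a \<in> carrier (Base X) \<Longrightarrow> antipode X (source X a) = target X a"
    and antipode_target: "a \<in> carrier (Base X) \<Longrightarrow> antipode X (target X a) = source X a"
    and antipode_involution: "h \<in> carrier (Total X) \<Longrightarrow> antipode X (antipode X h) = h"
    and antipode_left: "h \<in> carrier (Total X) \<Longrightarrow>
      tensor_lift (add_monoid (Total X))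
        (\<lambda>u v. antipode X u \<otimes>\<^bsub>Total X\<^esub> v) (comult X h) = target X (counit X h)"
    and antipode_right: "h \<in> carrier (Total X) \<Longrightarrow>
      tensor_lift (add_monoid (Total X))
        (\<lambda>u v. u \<otimes>\<^bsub>Total X\<^esub> antipode X v) (comult X h) = source X (counit X h)"

definition points :: "('k, 'q) ring_scheme \<Rightarrow> ('k, 'a, 'm) module_scheme \<Rightarrow> ('a \<Rightarrow> 'k) set"
  where "points K A = algebra_homs K A (algebra_via K (\<lambda>c. c))"

section \<open>Lie algebras of derivations\<close>

text \<open>The fields \<open>mult\<close> and \<open>one\<close> that a module record inherits from rings play no role.\<close>

record ('k, 'l) lie_data = "('k, 'l) module" +
  bracket :: "'l \<Rightarrow> 'l \<Rightarrow> 'l"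

locale lie_algebra = field K + module K L
  for K :: "('k, 'q) ring_scheme" and L :: "('k, 'l, 'z) lie_data_scheme" +
  assumes bracket_closed: "\<lbrakk>a \<in> carrier L; b \<in> carrier L\<rbrakk> \<Longrightarrow> bracket L a b \<in> carrier L"
    and bracket_add_left: "\<lbrakk>a \<in> carrier L; b \<in> carrier L; c \<in> carrier L\<rbrakk> \<Longrightarrow>
      bracket L (a \<oplus>\<^bsub>L\<^esub> b) c = bracket L a c \<oplus>\<^bsub>L\<^esub> bracket L b c"
    and bracket_add_right: "\<lbrakk>a \<in> carrier L; b \<in> carrier L; c \<in> carrier L\<rbrakk> \<Longrightarrow>
      bracket L a (b \<oplus>\<^bsub>L\<^esub> c) = bracket L a b \<oplus>\<^bsub>L\<^esub> bracket L a c"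
    and bracket_smult_left: "\<lbrakk>r \<in> carrier K; a \<in> carrier L; b \<in> carrier L\<rbrakk> \<Longrightarrow>
      bracket L (r \<odot>\<^bsub>L\<^esub> a) b = r \<odot>\<^bsub>L\<^esub> bracket L a b"
    and bracket_smult_right: "\<lbrakk>r \<in> carrier K; a \<in> carrier L; b \<in> carrier L\<rbrakk> \<Longrightarrow>
      bracket L a (r \<odot>\<^bsub>L\<^esub> b) = r \<odot>\<^bsub>L\<^esub> bracket L a b"
    and bracket_alternating: "a \<in> carrier L \<Longrightarrow> bracket L a a = \<zero>\<^bsub>L\<^esub>"
    and jacobi: "\<lbrakk>a \<in> carrier L; b \<in> carrier L; c \<in> carrier L\<rbrakk> \<Longrightarrow>
      bracket L a (bracket L b c) \<oplus>\<^bsub>L\<^esub> bracket L b (bracket L c a)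
        \<oplus>\<^bsub>L\<^esub> bracket L c (bracket L a b) = \<zero>\<^bsub>L\<^esub>"

definition lie_isos ::
    "('k, 'q) ring_scheme \<Rightarrow> ('k, 'l, 'm) lie_data_scheme \<Rightarrow> ('k, 'l', 'n) lie_data_scheme
      \<Rightarrow> ('l \<Rightarrow> 'l') set"
  where "lie_isos K L L' =
    {\<phi>. bij_betw \<phi> (carrier L) (carrier L')
      \<and> (\<forall>a \<in> carrier L. \<forall>b \<in> carrier L. \<phi> (a \<oplus>\<^bsub>L\<^esub> b) = \<phi> a \<oplus>\<^bsub>L'\<^esub> \<phi> b)
      \<and> (\<forall>r \<in> carrier K. \<forall>a \<in> carrier L. \<phi> (r \<odot>\<^bsub>L\<^esub> a) = r \<odot>\<^bsub>L'\<^esub> \<phi> a)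
      \<and> (\<forall>a \<in> carrier L. \<forall>b \<in> carrier L. \<phi> (bracket L a b) = bracket L' (\<phi> a) (\<phi> b))}"

text \<open>Derivations of a \<open>K\<close>-algebra \<open>B\<close> into \<open>K\<close>, regarded as a \<open>B\<close>-module via \<open>e\<close>. A functional on \<open>B\<close>
  is a HOL function that is \<open>undefined\<close> outside the carrier.\<close>

definition derivations ::
    "('k, 'q) ring_scheme \<Rightarrow> ('k, 'b, 'm) module_scheme \<Rightarrow> ('b \<Rightarrow> 'k) \<Rightarrow> ('b \<Rightarrow> 'k) set"
  where "derivations K B e =
    {\<delta> \<in> carrier B \<rightarrow>\<^sub>E carrier K.
        (\<forall>u \<in> carrier B. \<forall>v \<in> carrier B. \<delta> (u \<oplus>\<^bsub>B\<^esub> v) = \<delta> u \<oplus>\<^bsub>K\<^esub> \<delta> v)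
      \<and> (\<forall>c \<in> carrier K. \<forall>u \<in> carrier B. \<delta> (c \<odot>\<^bsub>B\<^esub> u) = c \<otimes>\<^bsub>K\<^esub> \<delta> u)
      \<and> (\<forall>u \<in> carrier B. \<forall>v \<in> carrier B.
           \<delta> (u \<otimes>\<^bsub>B\<^esub> v) = e u \<otimes>\<^bsub>K\<^esub> \<delta> v \<oplus>\<^bsub>K\<^esub> \<delta> u \<otimes>\<^bsub>K\<^esub> e v)}"

text \<open>A set \<open>V\<close> of functionals on \<open>B\<close> with the pointwise vector space operations and with the bracket
  \<open>u \<mapsto> \<gamma> u\<^sub>1 * \<gamma>' u\<^sub>2 - \<gamma>' u\<^sub>1 * \<gamma> u\<^sub>2\<close>, where \<open>D u = u\<^sub>1 \<otimes> u\<^sub>2\<close>.\<close>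

definition convolution_lie ::
    "('k, 'q) ring_scheme \<Rightarrow> ('k, 'b, 'm) module_scheme \<Rightarrow> ('b \<Rightarrow> ('b, 'b) tensor)
      \<Rightarrow> ('b \<Rightarrow> 'k) set \<Rightarrow> ('k, 'b \<Rightarrow> 'k) lie_data"
  where "convolution_lie K B D V =
    \<lparr>carrier = V, mult = undefined, one = undefined,
     zero = (\<lambda>u \<in> carrier B. \<zero>\<^bsub>K\<^esub>),
     add = (\<lambda>\<gamma> \<gamma>'. \<lambda>u \<in> carrier B. \<gamma> u \<oplus>\<^bsub>K\<^esub> \<gamma>' u),
     smult = (\<lambda>c \<gamma>. \<lambda>u \<in> carrier B. c \<otimes>\<^bsub>K\<^esub> \<gamma> u),
     bracket = (\<lambda>\<gamma> \<gamma>'. \<lambda>u \<in> carrier B.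
       tensor_lift (add_monoid K) (\<lambda>u\<^sub>1 u\<^sub>2. \<gamma> u\<^sub>1 \<otimes>\<^bsub>K\<^esub> \<gamma>' u\<^sub>2) (D u)
       \<ominus>\<^bsub>K\<^esub> tensor_lift (add_monoid K) (\<lambda>u\<^sub>1 u\<^sub>2. \<gamma>' u\<^sub>1 \<otimes>\<^bsub>K\<^esub> \<gamma> u\<^sub>2) (D u))\<rparr>"

definition source_derivations ::
    "('k, 'q) ring_scheme \<Rightarrow> ('k, 'a, 'h, 'z) hopf_algebroid_data_scheme \<Rightarrow> ('a \<Rightarrow> 'k)
      \<Rightarrow> ('h \<Rightarrow> 'k) set"
  where "source_derivations K X x =
    {\<delta> \<in> derivations K (Total X) (\<lambda>u. x (counit X u)). \<forall>a \<in> carrier (Base X). \<delta> (source X a) = \<zero>\<^bsub>K\<^esub>}"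

definition isotropy_lie ::
    "('k, 'q) ring_scheme \<Rightarrow> ('k, 'a, 'h, 'z) hopf_algebroid_data_scheme \<Rightarrow> ('a \<Rightarrow> 'k)
      \<Rightarrow> ('k, 'h \<Rightarrow> 'k) lie_data"
  where "isotropy_lie K X x = convolution_lie K (Total X) (comult X)
    {\<delta> \<in> source_derivations K X x. \<forall>a \<in> carrier (Base X). \<delta> (target X a) = \<zero>\<^bsub>K\<^esub>}"

section \<open>The isotropy Hopf algebra at a point\<close>

record ('k, 'b) hopf_data =
  Alg :: "('k, 'b) module"
  hopf_comult :: "'b \<Rightarrow> ('b, 'b) tensor"
  hopf_counit :: "'b \<Rightarrow> 'k"
  hopf_antipode :: "'b \<Rightarrow> 'b"

definition hopf_lie :: "('k, 'q) ring_scheme \<Rightarrow> ('k, 'b, 'z) hopf_data_scheme \<Rightarrow> ('k, 'b \<Rightarrow> 'k) lie_data"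
  where "hopf_lie K B =
    convolution_lie K (Alg B) (hopf_comult B) (derivations K (Alg B) (hopf_counit B))"

text \<open>\<open>K\<^sub>x \<otimes>\<^sub>A H \<otimes>\<^sub>A K\<^sub>x\<close> is bracketed to the left. In the left factor \<open>K\<^sub>x \<otimes>\<^sub>A H\<close> of the outer tensor
  product, \<open>A\<close> acts through \<open>a \<mapsto> 1 \<otimes> t a\<close>.\<close>

type_synonym ('k, 'h) isotropy = "(('k, 'h) tensor, 'k) tensor"

definition isotropy_left ::
    "('k, 'q) ring_scheme \<Rightarrow> ('k, 'a, 'h, 'z) hopf_algebroid_data_scheme \<Rightarrow> ('a \<Rightarrow> 'k)
      \<Rightarrow> ('a, ('k, 'h) tensor) module"
  where "isotropy_left K X x =
    algebra_via (tensor_algebra (Base X) (algebra_via K x) (via_source X))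
      (\<lambda>a. pure_tensor (Base X) (algebra_via K x) (via_source X) \<one>\<^bsub>K\<^esub> (target X a))"

definition isotropy_pure ::
    "('k, 'q) ring_scheme \<Rightarrow> ('k, 'a, 'h, 'z) hopf_algebroid_data_scheme \<Rightarrow> ('a \<Rightarrow> 'k)
      \<Rightarrow> 'k \<Rightarrow> 'h \<Rightarrow> 'k \<Rightarrow> ('k, 'h) isotropy"
  where "isotropy_pure K X x c u d =
    pure_tensor (Base X) (isotropy_left K X x) (algebra_via K x)
      (pure_tensor (Base X) (algebra_via K x) (via_source X) c u) d"

definition isotropy_algebra ::
    "('k, 'q) ring_scheme \<Rightarrow> ('k, 'a, 'h, 'z) hopf_algebroid_data_scheme \<Rightarrow> ('a \<Rightarrow> 'k)
      \<Rightarrow> ('k, ('k, 'h) isotropy) module"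
  where "isotropy_algebra K X x =
    algebra_via (tensor_algebra (Base X) (isotropy_left K X x) (algebra_via K x))
      (\<lambda>c. isotropy_pure K X x c \<one>\<^bsub>Total X\<^esub> \<one>\<^bsub>K\<^esub>)"

definition isotropy_lift ::
    "('g, 'y) monoid_scheme \<Rightarrow> ('k \<Rightarrow> 'h \<Rightarrow> 'k \<Rightarrow> 'g) \<Rightarrow> ('k, 'h) isotropy \<Rightarrow> 'g"
  where "isotropy_lift G f = tensor_lift G (\<lambda>Y d. tensor_lift G (\<lambda>c u. f c u d) Y)"

text \<open>The structure maps are the \<open>K\<close>-linear extensions of the formulas on the elements
  \<open>1 \<otimes> u \<otimes> 1\<close>, written out on all \<open>c \<otimes> u \<otimes> d\<close>; here \<open>c \<otimes> u \<otimes> d\<close> is the scalar multiple by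
  \<open>c * d\<close> of \<open>1 \<otimes> u \<otimes> 1\<close>.\<close>

definition isotropy_hopf ::
    "('k, 'q) ring_scheme \<Rightarrow> ('k, 'a, 'h, 'z) hopf_algebroid_data_scheme \<Rightarrow> ('a \<Rightarrow> 'k)
      \<Rightarrow> ('k, ('k, 'h) isotropy) hopf_data"
  where "isotropy_hopf K X x =
    (let B = isotropy_algebra K X x; BB = add_monoid (tensor_algebra K B B); el = isotropy_pure K X x in
     \<lparr>Alg = B,
      hopf_comult = isotropy_lift BB (\<lambda>c u d. tensor_lift BB (\<lambda>u\<^sub>1 u\<^sub>2.
        pure_tensor K B B (el c u\<^sub>1 \<one>\<^bsub>K\<^esub>) (el \<one>\<^bsub>K\<^esub> u\<^sub>2 d)) (comult X u)),
      hopf_counit = isotropy_lift (add_monoid K) (\<lambda>c u d. c \<otimes>\<^bsub>K\<^esub> x (counit X u) \<otimes>\<^bsub>K\<^esub> d),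
      hopf_antipode = isotropy_lift (add_monoid B) (\<lambda>c u d. el d (antipode X u) c)\<rparr>)"

end

theory Submission
  imports Defs
begin

text \<open>
  Call a functional \<open>\<alpha>\<close> from \<open>H\<close> to \<open>K\<close> bilinear if \<open>\<alpha> (s a * u) = x a * \<alpha> u = \<alpha> (t a * u)\<close>. Two bilinear
  functionals can be applied to the two factors of \<open>H \<otimes>\<^sub>A H\<close>, so they have a convolution product
  \<open>u \<mapsto> \<alpha> u\<^sub>1 * \<beta> u\<^sub>2\<close>. Coassociativity makes it associative (\<open>convolution_assoc\<close>) and the counit axioms
  make \<open>x \<circ> \<epsilon>\<close> its unit. The derivations that vanish on the images of \<open>s\<close> and \<open>t\<close> are the bilinear
  functionals that satisfy the product rule (\<open>L_iff\<close>). They are closed under the commutator, because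
  \<open>\<Delta>\<close> is multiplicative and the mixed terms \<open>\<delta> u * \<delta>' v + \<delta>' u * \<delta> v\<close> in the product rule for the
  convolution of \<open>\<delta>\<close> and \<open>\<delta>'\<close> are symmetric in \<open>\<delta>\<close> and \<open>\<delta>'\<close> (\<open>convolution_mult\<close>). A commutator in
  an associative algebra satisfies the Jacobi identity, so these derivations form a Lie algebra.

  For the comparison with the isotropy Hopf algebra, consider the map \<open>u \<mapsto> 1 \<otimes> u \<otimes> 1\<close> (\<open>proj\<close>). Scalars
  in the outer factors come from scalars of \<open>A\<close> and can be absorbed in the middle, so this is a
  surjective homomorphism of \<open>K\<close>-algebras (\<open>proj_surj\<close>). It is compatible with counits and
  comultiplications (\<open>counit_proj\<close>, \<open>comult_proj\<close>). The universal property of the tensor product says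
  that the bilinear functionals on \<open>H\<close> are exactly the composites of \<open>proj\<close> with a \<open>K\<close>-linear functional
  on the isotropy Hopf algebra. Therefore composition with
  \<open>proj\<close> is a bijection between the two spaces of derivations and respects the brackets
  (\<open>nabla_iso\<close>). In particular the bracket on the derivations of the isotropy Hopf algebra inherits the
  Lie algebra axioms (\<open>lie_algebra_transport\<close>).

  The tensor products are quotients of free abelian groups on pairs. Two facts suffice to work with
  them: induction over sums of pure tensors (\<open>tensor_induct\<close>), and the rule that a homomorphism moves
  inside a lift (\<open>lift_comp\<close>).
\<close>

section \<open>Tensor products of modules\<close>

locale tensor_modules = M: module R M + N: module R N
  for R :: "('r, 'q) ring_scheme" and M :: "('r, 'm, 'x) module_scheme"
    and N :: "('r, 'n, 'y) module_scheme"
begin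

abbreviation "T \<equiv> tensor_group R M N"
abbreviation "pure \<equiv> pure_tensor R M N"

lemma smult_closures:
  "\<forall>r \<in> carrier R. \<forall>m \<in> carrier M. r \<odot>\<^bsub>M\<^esub> m \<in> carrier M"
  "\<forall>r \<in> carrier R. \<forall>n \<in> carrier N. r \<odot>\<^bsub>N\<^esub> n \<in> carrier N"
  by auto

lemmas kernel_normal =
  tensor_kernel_normal[OF M.abelian_group_axioms N.abelian_group_axioms smult_closures]

lemma comm_group_tensor: "comm_group T"
  unfolding tensor_group_def
  by (intro comm_group.abelian_FactGroup abelian_free_Abelian_group normal_imp_subgroup kernel_normal)

sublocale T: comm_group T
  by (rule comm_group_tensor)

lemma coset_hom:
  "(\<lambda>F. tensor_kernel R M N #>\<^bsub>free_Abelian_group (carrier M \<times> carrier N)\<^esub> F)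
    \<in> hom (free_Abelian_group (carrier M \<times> carrier N)) T"
  unfolding tensor_group_def by (rule normal.r_coset_hom_Mod[OF kernel_normal])

lemma pure_closed [simp, intro]:
  "m \<in> carrier M \<Longrightarrow> n \<in> carrier N \<Longrightarrow> pure m n \<in> carrier T"
  using hom_in_carrier[OF coset_hom] by (simp add: pure_tensor_def)

text \<open>A relation \<open>F - F'\<close> lies in the kernel, so \<open>F = (F - F') + F'\<close> and \<open>F'\<close> have the same coset.\<close>

lemma coset_eq_of_relation:
  assumes "F - F' \<in> tensor_relations R M N"
    and F': "F' \<in> carrier (free_Abelian_group (carrier M \<times> carrier N))"
  shows "tensor_kernel R M N #>\<^bsub>free_Abelian_group (carrier M \<times> carrier N)\<^esub> F
    = tensor_kernel R M N #>\<^bsub>free_Abelian_group (carrier M \<times> carrier N)\<^esub> F'"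
proof -
  let ?F = "free_Abelian_group (carrier M \<times> carrier N)" and ?N = "tensor_kernel R M N"
  interpret N: normal ?N ?F by (rule kernel_normal)
  have mem: "F - F' \<in> ?N"
    unfolding tensor_kernel_def by (rule generate.incl) fact
  then have cl: "F - F' \<in> carrier ?F" using N.subset by blast
  have "?N #>\<^bsub>?F\<^esub> (F - F') = \<one>\<^bsub>T\<^esub>"
    using N.coset_join2[OF cl N.subgroup_axioms mem] by (simp add: tensor_group_def FactGroup_def)
  moreover have "F = (F - F') \<otimes>\<^bsub>?F\<^esub> F'" by simp
  ultimately show ?thesis
    using hom_mult[OF coset_hom cl F'] hom_in_carrier[OF coset_hom F'] T.l_one by metis
qed

lemma pure_add_left:
  assumes "m \<in> carrier M" "m' \<in> carrier M" "n \<in> carrier N"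
  shows "pure (m \<oplus>\<^bsub>M\<^esub> m') n = pure m n \<otimes>\<^bsub>T\<^esub> pure m' n"
proof -
  have "pure (m \<oplus>\<^bsub>M\<^esub> m') n
      = tensor_kernel R M N #>\<^bsub>free_Abelian_group (carrier M \<times> carrier N)\<^esub> (frag_of (m, n) + frag_of (m', n))"
    unfolding pure_tensor_def
    by (rule coset_eq_of_relation) (use assms in \<open>auto simp: tensor_relations_def dest!: keys_add[THEN subsetD]\<close>)
  then show ?thesis
    using hom_mult[OF coset_hom, of "frag_of (m, n)" "frag_of (m', n)"] assms
    by (simp add: pure_tensor_def)
qed

lemma pure_add_right:
  assumes "m \<in> carrier M" "n \<in> carrier N" "n' \<in> carrier N"
  shows "pure m (n \<oplus>\<^bsub>N\<^esub> n') = pure m n \<otimes>\<^bsub>T\<^esub> pure m n'"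
proof -
  have "pure m (n \<oplus>\<^bsub>N\<^esub> n')
      = tensor_kernel R M N #>\<^bsub>free_Abelian_group (carrier M \<times> carrier N)\<^esub> (frag_of (m, n) + frag_of (m, n'))"
    unfolding pure_tensor_def
    by (rule coset_eq_of_relation) (use assms in \<open>auto simp: tensor_relations_def dest!: keys_add[THEN subsetD]\<close>)
  then show ?thesis
    using hom_mult[OF coset_hom, of "frag_of (m, n)" "frag_of (m, n')"] assms
    by (simp add: pure_tensor_def)
qed

lemma pure_smult:
  assumes "r \<in> carrier R" "m \<in> carrier M" "n \<in> carrier N"
  shows "pure (r \<odot>\<^bsub>M\<^esub> m) n = pure m (r \<odot>\<^bsub>N\<^esub> n)"
  unfolding pure_tensor_def
  by (rule coset_eq_of_relation) (use assms in \<open>auto simp: tensor_relations_def\<close>)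

lemma pure_zero_left: "n \<in> carrier N \<Longrightarrow> pure \<zero>\<^bsub>M\<^esub> n = \<one>\<^bsub>T\<^esub>"
  using pure_add_left[of "\<zero>\<^bsub>M\<^esub>" "\<zero>\<^bsub>M\<^esub>" n] by (metis M.M.zero_closed M.M.r_zero T.l_cancel_one' pure_closed)

lemma pure_minus_left:
  assumes "m \<in> carrier M" "n \<in> carrier N"
  shows "pure (\<ominus>\<^bsub>M\<^esub> m) n = inv\<^bsub>T\<^esub> (pure m n)"
proof -
  have "pure (\<ominus>\<^bsub>M\<^esub> m) n \<otimes>\<^bsub>T\<^esub> pure m n = \<one>\<^bsub>T\<^esub>"
    using assms pure_zero_left by (simp flip: pure_add_left add: M.M.l_neg)
  then show ?thesis
    using T.inv_equality[of "pure (\<ominus>\<^bsub>M\<^esub> m) n" "pure m n"] assms by simp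
qed

text \<open>Every element is a sum of pure tensors: no inverses are needed, since
  \<open>- (m \<otimes> n) = (- m) \<otimes> n\<close>.\<close>

lemma tensor_induct [consumes 1, case_names pure add]:
  assumes X: "X \<in> carrier T"
    and pure: "\<And>m n. m \<in> carrier M \<Longrightarrow> n \<in> carrier N \<Longrightarrow> P (pure m n)"
    and add: "\<And>X Y. X \<in> carrier T \<Longrightarrow> Y \<in> carrier T \<Longrightarrow> P X \<Longrightarrow> P Y \<Longrightarrow> P (X \<otimes>\<^bsub>T\<^esub> Y)"
  shows "P X"
proof -
  let ?F = "free_Abelian_group (carrier M \<times> carrier N)"
  define c where "c = (\<lambda>F. tensor_kernel R M N #>\<^bsub>?F\<^esub> F)"
  interpret c: group_hom ?F T c
    using coset_hom by (simp add: group_hom_def group_hom_axioms_def c_def)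
  obtain F where F: "F \<in> carrier ?F" "X = c F"
    using X by (auto simp: tensor_group_def FactGroup_def RCOSETS_def c_def)
  have c_frag: "c (frag_of (m, n)) = pure_tensor R M N m n" for m n
    by (simp add: c_def pure_tensor_def)
  have c_neg: "c (- F) = inv\<^bsub>T\<^esub> (c F)" if "F \<in> carrier ?F" for F
    using c.hom_inv[OF that] that by simp
  have c_diff: "c (F - G) = c F \<otimes>\<^bsub>T\<^esub> c (- G)" if "F \<in> carrier ?F" "G \<in> carrier ?F" for F G
    using c.hom_mult[of F "- G"] that by simp
  have "Poly_Mapping.keys F \<subseteq> carrier M \<times> carrier N" using F by simp
  then have "P (c F) \<and> P (c (- F))"
  proof (rule free_Abelian_group_induct)
    have "c 0 = pure_tensor R M N \<zero>\<^bsub>M\<^esub> \<zero>\<^bsub>N\<^esub>"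
      using c.hom_one by (simp add: pure_zero_left)
    then show "P (c 0) \<and> P (c (- 0))" by (simp add: pure)
  next
    fix F G assume FG: "Poly_Mapping.keys F \<subseteq> carrier M \<times> carrier N" "Poly_Mapping.keys G \<subseteq> carrier M \<times> carrier N"
      "P (c F) \<and> P (c (- F))" "P (c G) \<and> P (c (- G))"
    then have *: "F \<in> carrier ?F" "- F \<in> carrier ?F" "G \<in> carrier ?F" "- G \<in> carrier ?F" by auto
    have "c (- (F - G)) = c G \<otimes>\<^bsub>T\<^esub> c (- F)"
      using c_diff[OF *(3,1)] by simp
    then show "P (c (F - G)) \<and> P (c (- (F - G)))"
      using FG(3,4) add c_diff[OF *(1,3)] c.hom_closed[OF *(1)] c.hom_closed[OF *(2)]
        c.hom_closed[OF *(3)] c.hom_closed[OF *(4)] by metis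
  next
    fix a assume a: "a \<in> carrier M \<times> carrier N"
    then show "P (c (frag_of a)) \<and> P (c (- frag_of a))"
      using pure[of "fst a" "snd a"] pure[of "\<ominus>\<^bsub>M\<^esub> fst a" "snd a"]
        c_frag[of "fst a" "snd a"] c_neg[of "frag_of a"]
      by (auto simp: pure_minus_left)
  qed
  with F show ?thesis by simp
qed

context
  fixes G :: "('g, 'z) monoid_scheme" and f :: "'m \<Rightarrow> 'n \<Rightarrow> 'g"
  assumes G: "comm_group G" and f: "balanced R M N G f"
begin

lemmas lift_hom = tensor_lift_hom[OF G M.abelian_group_axioms N.abelian_group_axioms smult_closures f]

lemmas lift_pure = tensor_lift_pure[OF G M.abelian_group_axioms N.abelian_group_axioms smult_closures f]

lemma lift_closed: "X \<in> carrier T \<Longrightarrow> tensor_lift G f X \<in> carrier G"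
  using hom_in_carrier[OF lift_hom] .

lemma lift_mult:
  "X \<in> carrier T \<Longrightarrow> Y \<in> carrier T \<Longrightarrow>
    tensor_lift G f (X \<otimes>\<^bsub>T\<^esub> Y) = tensor_lift G f X \<otimes>\<^bsub>G\<^esub> tensor_lift G f Y"
  using hom_mult[OF lift_hom] .

lemma lift_unique:
  assumes "h \<in> hom T G" and "\<And>m n. m \<in> carrier M \<Longrightarrow> n \<in> carrier N \<Longrightarrow> h (pure m n) = f m n"
    and "X \<in> carrier T"
  shows "h X = tensor_lift G f X"
  using assms(3)
  by (induction rule: tensor_induct)
     (simp_all add: assms(2) lift_pure lift_mult hom_mult[OF assms(1)])

lemma lift_cong:
  assumes "X \<in> carrier T"
    and eq: "\<And>m n. m \<in> carrier M \<Longrightarrow> n \<in> carrier N \<Longrightarrow> f' m n = f m n"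
  shows "tensor_lift G f' X = tensor_lift G f X"
proof -
  have f': "balanced R M N G f'"
    using f by (simp add: balanced_def eq)
  show ?thesis
    using assms(1) 
    by (intro lift_unique tensor_lift_hom[OF G M.abelian_group_axioms N.abelian_group_axioms smult_closures f'])
       (simp_all add: eq tensor_lift_pure[OF G M.abelian_group_axioms N.abelian_group_axioms smult_closures f'])
qed

lemma balanced_comp:
  assumes "h \<in> hom G G'"
  shows "balanced R M N G' (\<lambda>m n. h (f m n))"
  using f by (simp add: balanced_def hom_in_carrier[OF assms] hom_mult[OF assms])

text \<open>The rule by which a homomorphism is moved inside a Sweedler sum:
  \<open>h (f u\<^sub>1 u\<^sub>2) = (h \<circ> f) u\<^sub>1 u\<^sub>2\<close>.\<close>

lemma lift_comp:
  assumes G': "comm_group G'" and h: "h \<in> hom G G'" and X: "X \<in> carrier T"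
  shows "h (tensor_lift G f X) = tensor_lift G' (\<lambda>m n. h (f m n)) X"
  using X
proof (induction rule: tensor_induct)
  case (pure m n)
  then show ?case
    by (simp add: lift_pure tensor_lift_pure[OF G' M.abelian_group_axioms N.abelian_group_axioms
          smult_closures balanced_comp[OF h]])
next
  case (add X Y)
  then show ?case
    by (simp add: lift_mult lift_closed hom_mult[OF h] hom_mult[OF tensor_lift_hom[OF G'
      M.abelian_group_axioms N.abelian_group_axioms smult_closures balanced_comp[OF h]]])
qed

end

end

section \<open>Tensor products of algebras\<close>

lemma algebra_via_algebra:
  assumes "cring A" "cring B" and f: "f \<in> ring_hom A B"
  shows "algebra A (algebra_via B f)"
proof -
  interpret A: cring A by fact
  interpret B: cring B by fact
  note cl = ring_hom_closed[OF f]
  have B': "cring (algebra_via B f)"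
  proof (rule cringI)
    show "abelian_group (algebra_via B f)"
      by (rule abelian_groupI)
         (auto simp: algebra_via_def B.a_ac intro: B.add.l_inv_ex[simplified])
    show "comm_monoid (algebra_via B f)"
      by (rule comm_monoidI) (auto simp: algebra_via_def B.m_ac)
  qed (simp add: algebra_via_def B.l_distr)
  show ?thesis
    by (rule algebraI[OF \<open>cring A\<close> B'])
       (auto simp: algebra_via_def cl ring_hom_add[OF f] ring_hom_mult[OF f] ring_hom_one[OF f]
          B.l_distr B.r_distr B.m_assoc)
qed

locale tensor_algebras = M: algebra R M + N: algebra R N
  for R :: "('r, 'q) ring_scheme" and M :: "('r, 'm, 'x) module_scheme"
    and N :: "('r, 'n, 'y) module_scheme"
begin

sublocale tensor_modules R M N ..

abbreviation "TA \<equiv> tensor_algebra R M N"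

lemma tensor_algebra_simps [simp]:
  "carrier TA = carrier T" "add TA = mult T" "zero TA = one T" "one TA = pure \<one>\<^bsub>M\<^esub> \<one>\<^bsub>N\<^esub>"
  by (simp_all add: tensor_algebra_def Let_def)

text \<open>Multiplication of the tensor product is a lift in each of its two arguments. For a fixed pure
  tensor the inner lift is well defined, and its value is then balanced in that pure tensor, so
  the outer lift is well defined as well. All ring axioms follow by induction over sums of pure
  tensors.\<close>

lemma balanced_mult_pure:
  assumes "m \<in> carrier M" "n \<in> carrier N"
  shows "balanced R M N T (\<lambda>m' n'. pure (m \<otimes>\<^bsub>M\<^esub> m') (n \<otimes>\<^bsub>N\<^esub> n'))"
proof -
  have "m \<otimes>\<^bsub>M\<^esub> (r \<odot>\<^bsub>M\<^esub> m') = r \<odot>\<^bsub>M\<^esub> (m \<otimes>\<^bsub>M\<^esub> m')" "n \<otimes>\<^bsub>N\<^esub> (r \<odot>\<^bsub>N\<^esub> n') = r \<odot>\<^bsub>N\<^esub> (n \<otimes>\<^bsub>N\<^esub> n')"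
    if "r \<in> carrier R" "m' \<in> carrier M" "n' \<in> carrier N" for r m' n'
    using that assms M.smult_assoc2 N.smult_assoc2 by (metis M.m_comm M.smult_closed N.m_comm N.smult_closed)+
  then show ?thesis
    using assms
    by (simp add: balanced_def M.r_distr N.r_distr pure_add_left pure_add_right pure_smult)
qed

lemma balanced_mult:
  assumes Y: "Y \<in> carrier T"
  shows "balanced R M N T (\<lambda>m n. tensor_lift T (\<lambda>m' n'. pure (m \<otimes>\<^bsub>M\<^esub> m') (n \<otimes>\<^bsub>N\<^esub> n')) Y)"
    (is "balanced R M N T (\<lambda>m n. ?f m n Y)")
proof -
  note b = balanced_mult_pure
  note l = lift_pure[OF comm_group_tensor b] lift_mult[OF comm_group_tensor b]
    lift_closed[OF comm_group_tensor b]
  have "?f (m \<oplus>\<^bsub>M\<^esub> m') n Y = ?f m n Y \<otimes>\<^bsub>T\<^esub> ?f m' n Y"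
    if "m \<in> carrier M" "m' \<in> carrier M" "n \<in> carrier N" for m m' n
    using Y that
    by (induction rule: tensor_induct) (simp_all add: l M.l_distr pure_add_left T.m_ac)
  moreover have "?f m (n \<oplus>\<^bsub>N\<^esub> n') Y = ?f m n Y \<otimes>\<^bsub>T\<^esub> ?f m n' Y"
    if "m \<in> carrier M" "n \<in> carrier N" "n' \<in> carrier N" for m n n'
    using Y that
    by (induction rule: tensor_induct) (simp_all add: l N.l_distr pure_add_right T.m_ac)
  moreover have "?f (r \<odot>\<^bsub>M\<^esub> m) n Y = ?f m (r \<odot>\<^bsub>N\<^esub> n) Y"
    if "r \<in> carrier R" "m \<in> carrier M" "n \<in> carrier N" for r m n
    using Y that
    by (induction rule: tensor_induct) (simp_all add: l M.smult_assoc2 N.smult_assoc2 pure_smult)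
  ultimately show ?thesis
    using Y l(3) by (simp add: balanced_def)
qed

lemma mult_eq_lift:
  "X \<otimes>\<^bsub>TA\<^esub> Y = tensor_lift T (\<lambda>m n. tensor_lift T (\<lambda>m' n'. pure (m \<otimes>\<^bsub>M\<^esub> m') (n \<otimes>\<^bsub>N\<^esub> n')) Y) X"
  by (simp add: tensor_algebra_def Let_def)

lemma mult_pure [simp]:
  assumes "m \<in> carrier M" "n \<in> carrier N" "m' \<in> carrier M" "n' \<in> carrier N"
  shows "pure m n \<otimes>\<^bsub>TA\<^esub> pure m' n' = pure (m \<otimes>\<^bsub>M\<^esub> m') (n \<otimes>\<^bsub>N\<^esub> n')"
  using assms
  by (simp add: mult_eq_lift lift_pure[OF comm_group_tensor balanced_mult]
      lift_pure[OF comm_group_tensor balanced_mult_pure])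

lemma mult_closed [simp]: "X \<in> carrier T \<Longrightarrow> Y \<in> carrier T \<Longrightarrow> X \<otimes>\<^bsub>TA\<^esub> Y \<in> carrier T"
  unfolding mult_eq_lift by (rule lift_closed[OF comm_group_tensor balanced_mult])

lemma mult_add_left:
  "X \<in> carrier T \<Longrightarrow> X' \<in> carrier T \<Longrightarrow> Y \<in> carrier T \<Longrightarrow>
    (X \<otimes>\<^bsub>T\<^esub> X') \<otimes>\<^bsub>TA\<^esub> Y = (X \<otimes>\<^bsub>TA\<^esub> Y) \<otimes>\<^bsub>T\<^esub> (X' \<otimes>\<^bsub>TA\<^esub> Y)"
  unfolding mult_eq_lift by (rule lift_mult[OF comm_group_tensor balanced_mult])

lemma mult_add_right:
  assumes "X \<in> carrier T" "Y \<in> carrier T" "Y' \<in> carrier T"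
  shows "X \<otimes>\<^bsub>TA\<^esub> (Y \<otimes>\<^bsub>T\<^esub> Y') = (X \<otimes>\<^bsub>TA\<^esub> Y) \<otimes>\<^bsub>T\<^esub> (X \<otimes>\<^bsub>TA\<^esub> Y')"
  using assms
proof (induction rule: tensor_induct)
  case (pure m n)
  then show ?case
    by (simp add: mult_eq_lift lift_pure[OF comm_group_tensor balanced_mult]
        lift_mult[OF comm_group_tensor balanced_mult_pure])
next
  case (add X X')
  then show ?case
    by (simp add: mult_add_left T.m_ac)
qed

lemma mult_comm:
  assumes "X \<in> carrier T" "Y \<in> carrier T"
  shows "X \<otimes>\<^bsub>TA\<^esub> Y = Y \<otimes>\<^bsub>TA\<^esub> X"
  using assms
proof (induction rule: tensor_induct)
  case (pure m n)
  from pure(3,1,2) show ?case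
    by (induction rule: tensor_induct)
       (simp_all add: M.m_comm N.m_comm mult_add_left mult_add_right)
qed (simp add: mult_add_left mult_add_right)

lemma mult_assoc:
  assumes "X \<in> carrier T" "Y \<in> carrier T" "Z \<in> carrier T"
  shows "(X \<otimes>\<^bsub>TA\<^esub> Y) \<otimes>\<^bsub>TA\<^esub> Z = X \<otimes>\<^bsub>TA\<^esub> (Y \<otimes>\<^bsub>TA\<^esub> Z)"
  using assms
proof (induction rule: tensor_induct)
  case (pure m n)
  note X = pure(1,2)
  from pure(3,1,2,4) show ?case
  proof (induction rule: tensor_induct)
    case (pure m' n')
    from pure(5,1-4) show ?case
      by (induction rule: tensor_induct)
         (simp_all add: M.m_assoc N.m_assoc mult_add_right)
  qed (simp add: mult_add_left mult_add_right)
qed (simp add: mult_add_left)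

lemma mult_one:
  assumes "X \<in> carrier T"
  shows "pure \<one>\<^bsub>M\<^esub> \<one>\<^bsub>N\<^esub> \<otimes>\<^bsub>TA\<^esub> X = X"
  using assms by (induction rule: tensor_induct) (simp_all add: mult_add_right)

lemma tensor_cring: "cring TA"
proof (rule cringI)
  show "abelian_group TA"
    using T.l_inv_ex by (intro abelian_groupI) (auto simp: T.m_ac)
  show "comm_monoid TA"
    by (rule comm_monoidI) (simp_all add: mult_assoc mult_one, rule mult_comm)
qed (simp add: mult_add_left)

lemma comm_group_add_tensor: "comm_group (add_monoid TA)"
  by (intro abelian_group.a_comm_group ring.is_abelian_group cring.axioms(1) tensor_cring)

end

section \<open>Transport of Lie algebra structures\<close>

text \<open>The target is only a record whose operations correspond to those of a Lie algebra under a
  bijection; the axioms carry over. The zero element has to be matched separately, because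
  \<open>lie_isos\<close> does not mention it.\<close>

lemma lie_algebra_transport:
  assumes L: "lie_algebra K L" and \<phi>: "\<phi> \<in> lie_isos K L L'" and zero: "\<phi> \<zero>\<^bsub>L\<^esub> = \<zero>\<^bsub>L'\<^esub>"
  shows "lie_algebra K L'"
proof -
  interpret L: lie_algebra K L by (rule L)
  have carrier: "carrier L' = \<phi> ` carrier L"
    using \<phi> by (auto simp: lie_isos_def bij_betw_def)
  have add: "\<phi> a \<oplus>\<^bsub>L'\<^esub> \<phi> b = \<phi> (a \<oplus>\<^bsub>L\<^esub> b)" if "a \<in> carrier L" "b \<in> carrier L" for a b
    using \<phi> that by (simp add: lie_isos_def)
  have smult: "r \<odot>\<^bsub>L'\<^esub> \<phi> a = \<phi> (r \<odot>\<^bsub>L\<^esub> a)" if "r \<in> carrier K" "a \<in> carrier L" for r a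
    using \<phi> that by (simp add: lie_isos_def)
  have bracket: "bracket L' (\<phi> a) (\<phi> b) = \<phi> (bracket L a b)" if "a \<in> carrier L" "b \<in> carrier L" for a b
    using \<phi> that by (simp add: lie_isos_def)
  note ops = add smult bracket zero[symmetric] L.bracket_closed
  have group: "abelian_group L'"
  proof (rule abelian_groupI)
    fix a assume "a \<in> carrier L'"
    then obtain b where "b \<in> carrier L" "a = \<phi> b" by (auto simp: carrier)
    then show "\<exists>b \<in> carrier L'. b \<oplus>\<^bsub>L'\<^esub> a = \<zero>\<^bsub>L'\<^esub>"
      by (intro bexI[of _ "\<phi> (\<ominus>\<^bsub>L\<^esub> b)"]) (simp_all add: carrier ops L.M.l_neg)
  qed (auto simp: carrier ops L.M.a_ac)
  have module: "module K L'"
    by (rule moduleI[OF L.is_cring group])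
       (auto simp: carrier ops L.smult_l_distr L.smult_r_distr L.smult_assoc1)
  show ?thesis
    by (intro lie_algebra.intro lie_algebra_axioms.intro module L.field_axioms)
       (auto simp: carrier ops L.bracket_add_left L.bracket_add_right L.bracket_smult_left
          L.bracket_smult_right L.bracket_alternating L.jacobi)
qed

section \<open>Functionals on a Hopf algebroid at a point\<close>

locale pointed_hopf_algebroid = hopf_algebroid K X
  for K :: "('k, 'q) ring_scheme" and X :: "('k, 'a, 'h, 'z) hopf_algebroid_data_scheme" +
  fixes x :: "'a \<Rightarrow> 'k"
  assumes point: "x \<in> points K (Base X)"
begin

abbreviation "A \<equiv> Base X"
abbreviation "H \<equiv> Total X"
abbreviation "s \<equiv> source X"
abbreviation "t \<equiv> target X"
abbreviation "\<epsilon> \<equiv> counit X"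

sublocale K: field K by (rule field)
sublocale A: algebra K A by (rule base_algebra)
sublocale H: algebra K H by (rule total_algebra)

lemma algebra_homs_ring_hom: "f \<in> algebra_homs L B C \<Longrightarrow> f \<in> ring_hom B C"
  by (simp add: algebra_homs_def)

lemmas source_ring_hom = algebra_homs_ring_hom[OF source_hom]
lemmas target_ring_hom = algebra_homs_ring_hom[OF target_hom]
lemmas counit_ring_hom = algebra_homs_ring_hom[OF counit_hom]

lemma point_ring_hom: "x \<in> ring_hom A K"
  using point by (auto simp: points_def algebra_homs_def algebra_via_def ring_hom_def Pi_def)

lemma point_smult: "c \<in> carrier K \<Longrightarrow> a \<in> carrier A \<Longrightarrow> x (c \<odot>\<^bsub>A\<^esub> a) = c \<otimes>\<^bsub>K\<^esub> x a"
  using point by (auto simp: points_def algebra_homs_def algebra_via_def)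

lemma source_smult: "c \<in> carrier K \<Longrightarrow> a \<in> carrier A \<Longrightarrow> s (c \<odot>\<^bsub>A\<^esub> a) = c \<odot>\<^bsub>H\<^esub> s a"
  using source_hom by (auto simp: algebra_homs_def)

lemma target_smult: "c \<in> carrier K \<Longrightarrow> a \<in> carrier A \<Longrightarrow> t (c \<odot>\<^bsub>A\<^esub> a) = c \<odot>\<^bsub>H\<^esub> t a"
  using target_hom by (auto simp: algebra_homs_def)

lemmas structure_map_simps [simp] =
  ring_hom_closed[OF source_ring_hom] ring_hom_closed[OF target_ring_hom]
  ring_hom_closed[OF counit_ring_hom] ring_hom_closed[OF point_ring_hom]
  ring_hom_one[OF source_ring_hom] ring_hom_one[OF target_ring_hom]
  ring_hom_one[OF counit_ring_hom] ring_hom_one[OF point_ring_hom]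
  ring_hom_add[OF source_ring_hom] ring_hom_add[OF target_ring_hom]
  ring_hom_add[OF counit_ring_hom] ring_hom_add[OF point_ring_hom]
  ring_hom_mult[OF source_ring_hom] ring_hom_mult[OF target_ring_hom]
  ring_hom_mult[OF counit_ring_hom] ring_hom_mult[OF point_ring_hom]

lemma via_simps [simp]:
  "carrier (via_source X) = carrier H" "carrier (via_target X) = carrier H"
  "add (via_source X) = add H" "add (via_target X) = add H"
  "mult (via_source X) = mult H" "mult (via_target X) = mult H"
  "one (via_source X) = one H" "one (via_target X) = one H"
  "smult (via_source X) a u = s a \<otimes>\<^bsub>H\<^esub> u" "smult (via_target X) a u = t a \<otimes>\<^bsub>H\<^esub> u"
  by (simp_all add: via_source_def via_target_def algebra_via_def)

lemma counit_source [simp]: "a \<in> carrier A \<Longrightarrow> \<epsilon> (s a) = a"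
  using counit_bilinear[of a "\<one>\<^bsub>A\<^esub>" "\<one>\<^bsub>H\<^esub>"] by simp

lemma counit_target [simp]: "a \<in> carrier A \<Longrightarrow> \<epsilon> (t a) = a"
  using counit_bilinear[of "\<one>\<^bsub>A\<^esub>" a "\<one>\<^bsub>H\<^esub>"] by simp

lemma smult_eq_source: "c \<in> carrier K \<Longrightarrow> u \<in> carrier H \<Longrightarrow> c \<odot>\<^bsub>H\<^esub> u = s (c \<odot>\<^bsub>A\<^esub> \<one>\<^bsub>A\<^esub>) \<otimes>\<^bsub>H\<^esub> u"
  by (simp add: source_smult H.smult_assoc2)

lemma point_scalar: "c \<in> carrier K \<Longrightarrow> x (c \<odot>\<^bsub>A\<^esub> \<one>\<^bsub>A\<^esub>) = c"
  by (simp add: point_smult)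

lemma via_target_algebra: "algebra A (via_target X)"
  unfolding via_target_def
  by (rule algebra_via_algebra[OF A.M_cring H.M_cring target_ring_hom])

lemma via_source_algebra: "algebra A (via_source X)"
  unfolding via_source_def
  by (rule algebra_via_algebra[OF A.M_cring H.M_cring source_ring_hom])

sublocale HH: tensor_algebras A "via_target X" "via_source X"
  unfolding tensor_algebras_def using via_target_algebra via_source_algebra ..

lemma tensor2_simps [simp]:
  "carrier (tensor2 X) = carrier HH.T" "add (tensor2 X) = mult HH.T" "zero (tensor2 X) = one HH.T"
  "mult (tensor2 X) = mult HH.TA" "one (tensor2 X) = HH.pure \<one>\<^bsub>H\<^esub> \<one>\<^bsub>H\<^esub>"
  "pure2 X = HH.pure"
  by (simp_all add: tensor2_def pure2_def)

lemma comult_ring_hom: "comult X \<in> ring_hom H (tensor2 X)"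
  using comult_hom by (auto simp: algebra_homs_def algebra_via_def ring_hom_def Pi_def)

lemmas comult_simps [simp] =
  ring_hom_closed[OF comult_ring_hom, simplified] ring_hom_add[OF comult_ring_hom, simplified]

lemmas comult_mult = ring_hom_mult[OF comult_ring_hom, simplified]

lemma comult_source:
  assumes "a \<in> carrier A" "u \<in> carrier H"
  shows "comult X (s a \<otimes>\<^bsub>H\<^esub> u) = HH.pure (s a) \<one>\<^bsub>H\<^esub> \<otimes>\<^bsub>HH.TA\<^esub> comult X u"
  using comult_bilinear[of a "\<one>\<^bsub>A\<^esub>" u] assms HH.mult_one
  by (simp add: HH.mult_comm[of _ "HH.pure \<one>\<^bsub>H\<^esub> \<one>\<^bsub>H\<^esub>"])

lemma comult_target:
  assumes "a \<in> carrier A" "u \<in> carrier H"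
  shows "comult X (t a \<otimes>\<^bsub>H\<^esub> u) = HH.pure \<one>\<^bsub>H\<^esub> (t a) \<otimes>\<^bsub>HH.TA\<^esub> comult X u"
  using comult_bilinear[of "\<one>\<^bsub>A\<^esub>" a u] assms HH.mult_one
  by (simp add: HH.mult_comm[of _ "HH.pure \<one>\<^bsub>H\<^esub> (t a)"] H.m_comm[of u])

lemma tensor2_via_target_algebra: "algebra A (tensor2_via_target X)"
  unfolding tensor2_via_target_def
proof (rule algebra_via_algebra[OF A.M_cring])
  show "cring (tensor2 X)" unfolding tensor2_def by (rule HH.tensor_cring)
  show "(\<lambda>a. pure2 X \<one>\<^bsub>H\<^esub> (t a)) \<in> ring_hom A (tensor2 X)"
    by (rule ring_hom_memI) (simp_all add: HH.pure_add_right[simplified])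
qed

sublocale HHH: tensor_algebras A "tensor2_via_target X" "via_source X"
  unfolding tensor_algebras_def using tensor2_via_target_algebra via_source_algebra ..

lemma tensor2_via_target_simps [simp]:
  "carrier (tensor2_via_target X) = carrier HH.T" "add (tensor2_via_target X) = mult HH.T"
  "smult (tensor2_via_target X) a Y = HH.pure \<one>\<^bsub>H\<^esub> (t a) \<otimes>\<^bsub>HH.TA\<^esub> Y"
  by (simp_all add: tensor2_via_target_def algebra_via_def)

lemma tensor3_simps [simp]:
  "carrier (tensor3 X) = carrier HHH.T" "add (tensor3 X) = mult HHH.T" "zero (tensor3 X) = one HHH.T"
  "pure3 X = HHH.pure"
  by (simp_all add: tensor3_def pure3_def)

text \<open>The \<open>A\<close>-bilinear maps from \<open>H\<close> to \<open>K\<close>, where \<open>A\<close> acts on \<open>K\<close> through \<open>x\<close> on both sides. These are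
  the functionals that can be paired with the elements of \<open>H \<otimes>\<^sub>A H\<close>. They form an associative
  algebra under convolution whose unit is \<open>x \<circ> \<epsilon>\<close>, and the Lie bracket is its commutator.\<close>

definition bilinear_functionals :: "('h \<Rightarrow> 'k) set"
  where "bilinear_functionals = {\<alpha> \<in> carrier H \<rightarrow> carrier K.
      (\<forall>u \<in> carrier H. \<forall>v \<in> carrier H. \<alpha> (u \<oplus>\<^bsub>H\<^esub> v) = \<alpha> u \<oplus>\<^bsub>K\<^esub> \<alpha> v)
    \<and> (\<forall>a \<in> carrier A. \<forall>u \<in> carrier H. \<alpha> (s a \<otimes>\<^bsub>H\<^esub> u) = x a \<otimes>\<^bsub>K\<^esub> \<alpha> u)
    \<and> (\<forall>a \<in> carrier A. \<forall>u \<in> carrier H. \<alpha> (t a \<otimes>\<^bsub>H\<^esub> u) = x a \<otimes>\<^bsub>K\<^esub> \<alpha> u)}"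

abbreviation pairing :: "('h \<Rightarrow> 'k) \<Rightarrow> ('h \<Rightarrow> 'k) \<Rightarrow> ('h, 'h) tensor \<Rightarrow> 'k"
  where "pairing \<alpha> \<beta> \<equiv> tensor_lift (add_monoid K) (\<lambda>u v. \<alpha> u \<otimes>\<^bsub>K\<^esub> \<beta> v)"

definition convolution :: "('h \<Rightarrow> 'k) \<Rightarrow> ('h \<Rightarrow> 'k) \<Rightarrow> 'h \<Rightarrow> 'k"
  where "convolution \<alpha> \<beta> u = pairing \<alpha> \<beta> (comult X u)"

lemma bilinear_functionalD:
  assumes "\<alpha> \<in> bilinear_functionals"
  shows "u \<in> carrier H \<Longrightarrow> \<alpha> u \<in> carrier K"
    and "u \<in> carrier H \<Longrightarrow> v \<in> carrier H \<Longrightarrow> \<alpha> (u \<oplus>\<^bsub>H\<^esub> v) = \<alpha> u \<oplus>\<^bsub>K\<^esub> \<alpha> v"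
    and "a \<in> carrier A \<Longrightarrow> u \<in> carrier H \<Longrightarrow> \<alpha> (s a \<otimes>\<^bsub>H\<^esub> u) = x a \<otimes>\<^bsub>K\<^esub> \<alpha> u"
    and "a \<in> carrier A \<Longrightarrow> u \<in> carrier H \<Longrightarrow> \<alpha> (t a \<otimes>\<^bsub>H\<^esub> u) = x a \<otimes>\<^bsub>K\<^esub> \<alpha> u"
  using assms by (auto simp: bilinear_functionals_def)

text \<open>Linearity over \<open>K\<close> is the case of \<open>A\<close>-linearity for the scalars \<open>c \<cdot> 1\<close> of \<open>A\<close>, as \<open>x (c \<cdot> 1) = c\<close>.\<close>

lemma bilinear_functional_smult:
  assumes "\<alpha> \<in> bilinear_functionals" "c \<in> carrier K" "u \<in> carrier H"
  shows "\<alpha> (c \<odot>\<^bsub>H\<^esub> u) = c \<otimes>\<^bsub>K\<^esub> \<alpha> u"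
  using assms by (simp add: smult_eq_source bilinear_functionalD point_scalar)

lemma balanced_pairing:
  assumes "\<alpha> \<in> bilinear_functionals" "\<beta> \<in> bilinear_functionals"
  shows "balanced A (via_target X) (via_source X) (add_monoid K) (\<lambda>u v. \<alpha> u \<otimes>\<^bsub>K\<^esub> \<beta> v)"
  using assms
  by (simp add: balanced_def bilinear_functionalD K.l_distr K.r_distr K.m_ac)

context
  fixes \<alpha> \<beta>
  assumes ab: "\<alpha> \<in> bilinear_functionals" "\<beta> \<in> bilinear_functionals"
begin

lemma pairing_pure [simp]:
  "u \<in> carrier H \<Longrightarrow> v \<in> carrier H \<Longrightarrow> pairing \<alpha> \<beta> (HH.pure u v) = \<alpha> u \<otimes>\<^bsub>K\<^esub> \<beta> v"
  by (simp add: HH.lift_pure[OF K.a_comm_group balanced_pairing[OF ab]])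

lemma pairing_add [simp]:
  "Y \<in> carrier HH.T \<Longrightarrow> Z \<in> carrier HH.T \<Longrightarrow>
    pairing \<alpha> \<beta> (Y \<otimes>\<^bsub>HH.T\<^esub> Z) = pairing \<alpha> \<beta> Y \<oplus>\<^bsub>K\<^esub> pairing \<alpha> \<beta> Z"
  by (simp add: HH.lift_mult[OF K.a_comm_group balanced_pairing[OF ab]])

lemma pairing_closed [simp]: "Y \<in> carrier HH.T \<Longrightarrow> pairing \<alpha> \<beta> Y \<in> carrier K"
  using HH.lift_closed[OF K.a_comm_group balanced_pairing[OF ab]] by simp

lemma convolution_closed [simp]: "u \<in> carrier H \<Longrightarrow> convolution \<alpha> \<beta> u \<in> carrier K"
  by (simp add: convolution_def)

lemma pairing_source:
  assumes "Y \<in> carrier HH.T" "a \<in> carrier A"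
  shows "pairing \<alpha> \<beta> (HH.pure (s a) \<one>\<^bsub>H\<^esub> \<otimes>\<^bsub>HH.TA\<^esub> Y) = x a \<otimes>\<^bsub>K\<^esub> pairing \<alpha> \<beta> Y"
  using assms
  by (induction rule: HH.tensor_induct)
     (simp_all add: HH.mult_add_right bilinear_functionalD[OF ab(1)] bilinear_functionalD[OF ab(2)]
        K.m_assoc K.r_distr)

lemma pairing_target:
  assumes "Y \<in> carrier HH.T" "a \<in> carrier A"
  shows "pairing \<alpha> \<beta> (HH.pure \<one>\<^bsub>H\<^esub> (t a) \<otimes>\<^bsub>HH.TA\<^esub> Y) = x a \<otimes>\<^bsub>K\<^esub> pairing \<alpha> \<beta> Y"
  using assms
  by (induction rule: HH.tensor_induct)
     (simp_all add: HH.mult_add_right bilinear_functionalD[OF ab(1)] bilinear_functionalD[OF ab(2)]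
        K.m_lcomm K.r_distr)

lemma convolution_bilinear: "convolution \<alpha> \<beta> \<in> bilinear_functionals"
  by (simp add: bilinear_functionals_def convolution_def comult_source comult_target
      pairing_source pairing_target)

end

lemma pairing_cong:
  assumes "\<alpha> \<in> bilinear_functionals" "\<beta> \<in> bilinear_functionals" "Y \<in> carrier HH.T"
    and "\<And>u. u \<in> carrier H \<Longrightarrow> \<alpha>' u = \<alpha> u" "\<And>u. u \<in> carrier H \<Longrightarrow> \<beta>' u = \<beta> u"
  shows "pairing \<alpha>' \<beta>' Y = pairing \<alpha> \<beta> Y"
  by (rule HH.lift_cong[OF K.a_comm_group balanced_pairing]) (simp_all add: assms)

lemma counit_bilinear_functional: "(\<lambda>u. x (\<epsilon> u)) \<in> bilinear_functionals"
  by (simp add: bilinear_functionals_def)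

lemma additive_hom:
  assumes "\<alpha> \<in> bilinear_functionals"
  shows "\<alpha> \<in> hom (add_monoid H) (add_monoid K)"
  using assms by (auto intro!: homI simp: bilinear_functionalD)

text \<open>Apply \<open>\<alpha>\<close> to the counit axiom \<open>s (\<epsilon> u\<^sub>1) u\<^sub>2 = u\<close> and use that \<open>\<alpha>\<close> is linear with respect to \<open>s\<close>.\<close>

lemma counit_convolution:
  assumes \<alpha>: "\<alpha> \<in> bilinear_functionals" and u: "u \<in> carrier H"
  shows "pairing (\<lambda>u. x (\<epsilon> u)) \<alpha> (comult X u) = \<alpha> u"
proof -
  have bal: "balanced A (via_target X) (via_source X) (add_monoid H) (\<lambda>u v. s (\<epsilon> u) \<otimes>\<^bsub>H\<^esub> v)"
    by (simp add: balanced_def H.l_distr H.r_distr H.m_ac)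
  have "\<alpha> u = \<alpha> (tensor_lift (add_monoid H) (\<lambda>u v. s (\<epsilon> u) \<otimes>\<^bsub>H\<^esub> v) (comult X u))"
    using counit_left[OF u] by simp
  also have "\<dots> = tensor_lift (add_monoid K) (\<lambda>u v. \<alpha> (s (\<epsilon> u) \<otimes>\<^bsub>H\<^esub> v)) (comult X u)"
    using u by (intro HH.lift_comp[OF H.a_comm_group bal K.a_comm_group additive_hom[OF \<alpha>]]) simp
  also have "\<dots> = pairing (\<lambda>u. x (\<epsilon> u)) \<alpha> (comult X u)"
    using u by (intro HH.lift_cong[OF K.a_comm_group balanced_pairing[OF counit_bilinear_functional \<alpha>]])
      (simp_all add: bilinear_functionalD[OF \<alpha>])
  finally show ?thesis ..
qed

text \<open>The mirror image, from \<open>u\<^sub>1 t (\<epsilon> u\<^sub>2) = u\<close> and linearity with respect to \<open>t\<close>.\<close>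

lemma convolution_counit:
  assumes \<alpha>: "\<alpha> \<in> bilinear_functionals" and u: "u \<in> carrier H"
  shows "pairing \<alpha> (\<lambda>u. x (\<epsilon> u)) (comult X u) = \<alpha> u"
proof -
  have bal: "balanced A (via_target X) (via_source X) (add_monoid H) (\<lambda>u v. u \<otimes>\<^bsub>H\<^esub> t (\<epsilon> v))"
    by (simp add: balanced_def H.l_distr H.r_distr H.m_ac)
  have "\<alpha> u = \<alpha> (tensor_lift (add_monoid H) (\<lambda>u v. u \<otimes>\<^bsub>H\<^esub> t (\<epsilon> v)) (comult X u))"
    using counit_right[OF u] by simp
  also have "\<dots> = tensor_lift (add_monoid K) (\<lambda>u v. \<alpha> (u \<otimes>\<^bsub>H\<^esub> t (\<epsilon> v))) (comult X u)"
    using u by (intro HH.lift_comp[OF H.a_comm_group bal K.a_comm_group additive_hom[OF \<alpha>]]) simp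
  also have "\<dots> = pairing \<alpha> (\<lambda>u. x (\<epsilon> u)) (comult X u)"
    using u by (intro HH.lift_cong[OF K.a_comm_group balanced_pairing[OF \<alpha> counit_bilinear_functional]])
      (simp_all add: bilinear_functionalD[OF \<alpha>] H.m_comm[of _ "t _"] K.m_comm)
  finally show ?thesis ..
qed

lemma pairing_diff_right:
  assumes "\<alpha> \<in> bilinear_functionals" "\<beta> \<in> bilinear_functionals" "\<gamma> \<in> bilinear_functionals"
    and "\<phi> \<in> bilinear_functionals" and "\<And>u. u \<in> carrier H \<Longrightarrow> \<phi> u = \<beta> u \<ominus>\<^bsub>K\<^esub> \<gamma> u"
    and "Y \<in> carrier HH.T"
  shows "pairing \<alpha> \<phi> Y = pairing \<alpha> \<beta> Y \<ominus>\<^bsub>K\<^esub> pairing \<alpha> \<gamma> Y"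
  using assms(6)
  by (induction rule: HH.tensor_induct)
     (simp_all add: assms(1-5) bilinear_functionalD(1) K.minus_eq K.r_distr K.r_minus K.minus_add K.a_ac)

lemma pairing_diff_left:
  assumes "\<alpha> \<in> bilinear_functionals" "\<beta> \<in> bilinear_functionals" "\<gamma> \<in> bilinear_functionals"
    and "\<phi> \<in> bilinear_functionals" and "\<And>u. u \<in> carrier H \<Longrightarrow> \<phi> u = \<beta> u \<ominus>\<^bsub>K\<^esub> \<gamma> u"
    and "Y \<in> carrier HH.T"
  shows "pairing \<phi> \<alpha> Y = pairing \<beta> \<alpha> Y \<ominus>\<^bsub>K\<^esub> pairing \<gamma> \<alpha> Y"
  using assms(6)
  by (induction rule: HH.tensor_induct)
     (simp_all add: assms(1-5) bilinear_functionalD(1) K.minus_eq K.l_distr K.l_minus K.minus_add K.a_ac)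

text \<open>Apply to both sides of coassociativity the functional \<open>(u \<otimes> v) \<otimes> w \<mapsto> \<alpha> u * \<beta> v * \<gamma> w\<close>, which is
  well defined on the threefold tensor product because \<open>\<alpha>\<close>, \<open>\<beta>\<close> and \<open>\<gamma>\<close> are bilinear.\<close>

lemma convolution_assoc:
  assumes abc: "\<alpha> \<in> bilinear_functionals" "\<beta> \<in> bilinear_functionals" "\<gamma> \<in> bilinear_functionals"
    and h: "h \<in> carrier H"
  shows "convolution (convolution \<alpha> \<beta>) \<gamma> h = convolution \<alpha> (convolution \<beta> \<gamma>) h"
proof -
  note D = bilinear_functionalD[OF abc(1)] bilinear_functionalD[OF abc(2)] bilinear_functionalD[OF abc(3)]
  let ?G = "add_monoid (tensor3 X)"
  define \<Phi> where "\<Phi> = tensor_lift (add_monoid K) (\<lambda>Y w. pairing \<alpha> \<beta> Y \<otimes>\<^bsub>K\<^esub> \<gamma> w)"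
  have G: "comm_group ?G" unfolding tensor3_def by (rule HHH.comm_group_add_tensor)
  have bal: "balanced A (tensor2_via_target X) (via_source X) (add_monoid K)
      (\<lambda>Y w. pairing \<alpha> \<beta> Y \<otimes>\<^bsub>K\<^esub> \<gamma> w)"
    using abc by (simp add: balanced_def D K.l_distr K.r_distr pairing_target K.m_ac)
  have \<Phi>_pure: "\<Phi> (HHH.pure Y w) = pairing \<alpha> \<beta> Y \<otimes>\<^bsub>K\<^esub> \<gamma> w"
    if "Y \<in> carrier HH.T" "w \<in> carrier H" for Y w
    using that by (simp add: \<Phi>_def HHH.lift_pure[OF K.a_comm_group bal])
  have \<Phi>: "\<Phi> \<in> hom ?G (add_monoid K)"
    using HHH.lift_hom[OF K.a_comm_group bal] by (simp add: \<Phi>_def hom_def)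
  have bal_left: "balanced A (via_target X) (via_source X) ?G (\<lambda>u v. HHH.pure (comult X u) v)"
    using HHH.pure_smult[simplified]
    by (simp add: balanced_def HHH.pure_add_left[simplified] HHH.pure_add_right[simplified] comult_target)
  have "\<Phi> (tensor_lift ?G (\<lambda>u v. HHH.pure (comult X u) v) (comult X h))
      = tensor_lift (add_monoid K) (\<lambda>u v. \<Phi> (HHH.pure (comult X u) v)) (comult X h)"
    using h by (intro HH.lift_comp[OF G bal_left K.a_comm_group \<Phi>]) simp
  also have "\<dots> = convolution (convolution \<alpha> \<beta>) \<gamma> h"
    unfolding convolution_def[of "convolution \<alpha> \<beta>"] using h abc
    by (intro HH.lift_cong[OF K.a_comm_group balanced_pairing[OF convolution_bilinear[OF abc(1,2)] abc(3)]])
       (simp_all add: \<Phi>_pure convolution_def)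
  finally have left: "\<Phi> (tensor_lift ?G (\<lambda>u v. HHH.pure (comult X u) v) (comult X h))
      = convolution (convolution \<alpha> \<beta>) \<gamma> h" .
  \<comment> \<open>\<open>g u Y\<close> is \<open>u \<otimes> Y\<close>, rebracketed to the left.\<close>
  define g where "g = (\<lambda>u. tensor_lift ?G (\<lambda>v w. HHH.pure (HH.pure u v) w))"
  have bal_inner: "balanced A (via_target X) (via_source X) ?G (\<lambda>v w. HHH.pure (HH.pure u v) w)"
    if "u \<in> carrier H" for u
    using that HHH.pure_smult[simplified, symmetric]
    by (simp add: balanced_def HHH.pure_add_left[simplified] HHH.pure_add_right[simplified]
        HH.pure_add_right[simplified])
  have g_simps [simp]:
    "g u (HH.pure v w) = HHH.pure (HH.pure u v) w"
    "Y \<in> carrier HH.T \<Longrightarrow> g u Y \<in> carrier HHH.T"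
    "Y \<in> carrier HH.T \<Longrightarrow> Z \<in> carrier HH.T \<Longrightarrow> g u (Y \<otimes>\<^bsub>HH.T\<^esub> Z) = g u Y \<otimes>\<^bsub>HHH.T\<^esub> g u Z"
    if "u \<in> carrier H" "v \<in> carrier H" "w \<in> carrier H" for u v w Y Z
    using that HH.lift_pure[OF G bal_inner] HH.lift_closed[OF G bal_inner] HH.lift_mult[OF G bal_inner]
    by (simp_all add: g_def)
  have g_add: "g (u \<oplus>\<^bsub>H\<^esub> u') Y = g u Y \<otimes>\<^bsub>HHH.T\<^esub> g u' Y"
    if "u \<in> carrier H" "u' \<in> carrier H" "Y \<in> carrier HH.T" for u u' Y
    using that(3,1,2)
    by (induction rule: HH.tensor_induct)
       (simp_all add: HH.pure_add_left[simplified] HHH.pure_add_left[simplified] HHH.T.m_ac)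
  have g_target: "g (t a \<otimes>\<^bsub>H\<^esub> u) Y = g u (HH.pure (s a) \<one>\<^bsub>H\<^esub> \<otimes>\<^bsub>HH.TA\<^esub> Y)"
    if "a \<in> carrier A" "u \<in> carrier H" "Y \<in> carrier HH.T" for a u Y
    using that(3,1,2) HH.pure_smult[simplified]
    by (induction rule: HH.tensor_induct) (simp_all add: HH.mult_add_right)
  have bal_right: "balanced A (via_target X) (via_source X) ?G (\<lambda>u v. g u (comult X v))"
    by (simp add: balanced_def g_add g_target comult_source)
  have "\<Phi> (tensor_lift ?G (\<lambda>u v. g u (comult X v)) (comult X h))
      = tensor_lift (add_monoid K) (\<lambda>u v. \<Phi> (g u (comult X v))) (comult X h)"
    using h by (intro HH.lift_comp[OF G bal_right K.a_comm_group \<Phi>]) simp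
  also have "\<dots> = convolution \<alpha> (convolution \<beta> \<gamma>) h"
  proof -
    have \<Phi>_add: "\<Phi> (Y \<otimes>\<^bsub>HHH.T\<^esub> Z) = \<Phi> Y \<oplus>\<^bsub>K\<^esub> \<Phi> Z" if "Y \<in> carrier HHH.T" "Z \<in> carrier HHH.T" for Y Z
      using hom_mult[OF \<Phi>] that by simp
    have "\<Phi> (g u Y) = \<alpha> u \<otimes>\<^bsub>K\<^esub> pairing \<beta> \<gamma> Y" if "u \<in> carrier H" "Y \<in> carrier HH.T" for u Y
      using that(2,1) abc
      by (induction rule: HH.tensor_induct) (simp_all add: \<Phi>_pure \<Phi>_add D K.m_assoc K.r_distr)
    then show ?thesis
      unfolding convolution_def[of _ "convolution \<beta> \<gamma>"] using h abc
      by (intro HH.lift_cong[OF K.a_comm_group balanced_pairing[OF abc(1) convolution_bilinear[OF abc(2,3)]]])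
         (simp_all add: convolution_def)
  qed
  finally show ?thesis
    using left coassoc[OF h] by (simp add: g_def)
qed

section \<open>The Lie algebra of derivations at a point\<close>

abbreviation "L \<equiv> isotropy_lie K X x"

lemma convolution_lie_simps [simp]:
  "carrier (convolution_lie K B D V) = V"
  "\<zero>\<^bsub>convolution_lie K B D V\<^esub> = (\<lambda>u \<in> carrier B. \<zero>\<^bsub>K\<^esub>)"
  "\<gamma> \<oplus>\<^bsub>convolution_lie K B D V\<^esub> \<gamma>' = (\<lambda>u \<in> carrier B. \<gamma> u \<oplus>\<^bsub>K\<^esub> \<gamma>' u)"
  "c \<odot>\<^bsub>convolution_lie K B D V\<^esub> \<gamma> = (\<lambda>u \<in> carrier B. c \<otimes>\<^bsub>K\<^esub> \<gamma> u)"
  by (simp_all add: convolution_lie_def)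

lemma bracket_convolution_lie:
  "bracket (convolution_lie K B D V) \<gamma> \<gamma>' = (\<lambda>u \<in> carrier B.
       tensor_lift (add_monoid K) (\<lambda>u\<^sub>1 u\<^sub>2. \<gamma> u\<^sub>1 \<otimes>\<^bsub>K\<^esub> \<gamma>' u\<^sub>2) (D u)
       \<ominus>\<^bsub>K\<^esub> tensor_lift (add_monoid K) (\<lambda>u\<^sub>1 u\<^sub>2. \<gamma>' u\<^sub>1 \<otimes>\<^bsub>K\<^esub> \<gamma> u\<^sub>2) (D u))"
  by (simp add: convolution_lie_def)

lemma bracket_L: 
  "u \<in> carrier H \<Longrightarrow> bracket L \<gamma> \<gamma>' u = convolution \<gamma> \<gamma>' u \<ominus>\<^bsub>K\<^esub> convolution \<gamma>' \<gamma> u"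
  by (simp add: isotropy_lie_def bracket_convolution_lie convolution_def)

lemma L_apply [simp]:
  assumes "u \<in> carrier H"
  shows "\<zero>\<^bsub>L\<^esub> u = \<zero>\<^bsub>K\<^esub>" "(\<gamma> \<oplus>\<^bsub>L\<^esub> \<gamma>') u = \<gamma> u \<oplus>\<^bsub>K\<^esub> \<gamma>' u" "(c \<odot>\<^bsub>L\<^esub> \<gamma>) u = c \<otimes>\<^bsub>K\<^esub> \<gamma> u"
  using assms by (simp_all add: isotropy_lie_def)

lemma L_extensional [simp]:
  "\<zero>\<^bsub>L\<^esub> \<in> extensional (carrier H)" "\<gamma> \<oplus>\<^bsub>L\<^esub> \<gamma>' \<in> extensional (carrier H)"
  "c \<odot>\<^bsub>L\<^esub> \<gamma> \<in> extensional (carrier H)" "bracket L \<gamma> \<gamma>' \<in> extensional (carrier H)"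
  by (simp_all add: isotropy_lie_def bracket_convolution_lie)

text \<open>For an \<open>x \<circ> \<epsilon>\<close>-derivation the vanishing on \<open>s A\<close> and \<open>t A\<close> is the same as bilinearity: the product
  rule for \<open>s a * u\<close> reads \<open>\<delta> (s a * u) = x a * \<delta> u + \<delta> (s a) * x (\<epsilon> u)\<close>, since \<open>\<epsilon> (s a) = a\<close>, and
  likewise for \<open>t\<close>. Conversely a bilinear \<open>\<delta>\<close> satisfies \<open>\<delta> (s a) = x a * \<delta> 1\<close>, and the product rule
  for \<open>1 * 1\<close> gives \<open>\<delta> 1 = 0\<close>.\<close>

lemma L_iff:
  "\<delta> \<in> carrier L \<longleftrightarrow> \<delta> \<in> bilinear_functionals \<and> \<delta> \<in> extensional (carrier H)
    \<and> (\<forall>u \<in> carrier H. \<forall>v \<in> carrier H.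
        \<delta> (u \<otimes>\<^bsub>H\<^esub> v) = x (\<epsilon> u) \<otimes>\<^bsub>K\<^esub> \<delta> v \<oplus>\<^bsub>K\<^esub> \<delta> u \<otimes>\<^bsub>K\<^esub> x (\<epsilon> v))"
    (is "_ \<longleftrightarrow> ?b \<and> ?e \<and> ?d")
proof
  assume \<delta>: "\<delta> \<in> carrier L"
  then show "?b \<and> ?e \<and> ?d"
    by (auto simp: isotropy_lie_def source_derivations_def derivations_def bilinear_functionals_def PiE_iff)
next
  assume \<delta>: "?b \<and> ?e \<and> ?d"
  then have b: "\<delta> \<in> bilinear_functionals" by simp
  note D = bilinear_functionalD[OF b]
  have "\<delta> \<one>\<^bsub>H\<^esub> = \<delta> \<one>\<^bsub>H\<^esub> \<oplus>\<^bsub>K\<^esub> \<delta> \<one>\<^bsub>H\<^esub>"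
    using \<delta>[THEN conjunct2, THEN conjunct2, rule_format, of "\<one>\<^bsub>H\<^esub>" "\<one>\<^bsub>H\<^esub>"] D(1) by simp
  then have one: "\<delta> \<one>\<^bsub>H\<^esub> = \<zero>\<^bsub>K\<^esub>"
    using D(1)[OF H.one_closed] by (metis K.add.l_cancel_one)
  have "\<delta> (s a) = \<zero>\<^bsub>K\<^esub>" "\<delta> (t a) = \<zero>\<^bsub>K\<^esub>" if "a \<in> carrier A" for a
    using D(3)[OF that H.one_closed] D(4)[OF that H.one_closed] one that by simp_all
  then show "\<delta> \<in> carrier L"
    using \<delta> D bilinear_functional_smult[OF b]
    by (simp add: isotropy_lie_def source_derivations_def derivations_def PiE_iff)
qed

lemma L_D:
  assumes "\<delta> \<in> carrier L"
  shows "\<delta> \<in> bilinear_functionals" "\<delta> \<in> extensional (carrier H)"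
    "u \<in> carrier H \<Longrightarrow> \<delta> u \<in> carrier K"
    "u \<in> carrier H \<Longrightarrow> v \<in> carrier H \<Longrightarrow>
      \<delta> (u \<otimes>\<^bsub>H\<^esub> v) = x (\<epsilon> u) \<otimes>\<^bsub>K\<^esub> \<delta> v \<oplus>\<^bsub>K\<^esub> \<delta> u \<otimes>\<^bsub>K\<^esub> x (\<epsilon> v)"
  using assms by (auto simp: L_iff dest: bilinear_functionalD)

lemmas L_eqI = extensionalityI[where A = "carrier H"]

text \<open>Since \<open>\<Delta>\<close> is multiplicative, the left side pairs \<open>\<delta> \<otimes> \<delta>'\<close> with \<open>\<Delta> u * \<Delta> v\<close>. Expanding both product
  rules gives four terms, which the counit axioms simplify. The last two are symmetric in \<open>\<delta>\<close> and \<open>\<delta>'\<close>,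
  so they cancel in the commutator: this is why the bracket of derivations is a derivation.\<close>

lemma convolution_mult:
  assumes \<delta>: "\<delta> \<in> carrier L" and \<delta>': "\<delta>' \<in> carrier L" and u: "u \<in> carrier H" and v: "v \<in> carrier H"
  shows "convolution \<delta> \<delta>' (u \<otimes>\<^bsub>H\<^esub> v)
    = x (\<epsilon> u) \<otimes>\<^bsub>K\<^esub> convolution \<delta> \<delta>' v \<oplus>\<^bsub>K\<^esub> convolution \<delta> \<delta>' u \<otimes>\<^bsub>K\<^esub> x (\<epsilon> v)
      \<oplus>\<^bsub>K\<^esub> (\<delta> u \<otimes>\<^bsub>K\<^esub> \<delta>' v \<oplus>\<^bsub>K\<^esub> \<delta>' u \<otimes>\<^bsub>K\<^esub> \<delta> v)"
proof -
  define e where "e = (\<lambda>u. x (\<epsilon> u))"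
  note b = counit_bilinear_functional[folded e_def] L_D(1)[OF \<delta>] L_D(1)[OF \<delta>']
  have e_closed: "e u \<in> carrier K" if "u \<in> carrier H" for u
    using that by (simp add: e_def)
  have e_apply: "x (\<epsilon> u) = e u" for u
    by (simp add: e_def)
  have e_mult: "e (u \<otimes>\<^bsub>H\<^esub> v) = e u \<otimes>\<^bsub>K\<^esub> e v" if "u \<in> carrier H" "v \<in> carrier H" for u v
    using that by (simp add: e_def)
  have conv_e: "pairing e \<alpha> (comult X u) = \<alpha> u" "pairing \<alpha> e (comult X u) = \<alpha> u"
    if "\<alpha> \<in> bilinear_functionals" "u \<in> carrier H" for \<alpha> u
    unfolding e_def by (rule counit_convolution[OF that], rule convolution_counit[OF that])
  note simps = b e_closed e_mult L_D(3)[OF \<delta>] L_D(3)[OF \<delta>']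
    L_D(4)[OF \<delta>, unfolded e_apply] L_D(4)[OF \<delta>', unfolded e_apply]
  have expand: "pairing \<delta> \<delta>' (Y \<otimes>\<^bsub>HH.TA\<^esub> Z)
      = pairing e e Y \<otimes>\<^bsub>K\<^esub> pairing \<delta> \<delta>' Z \<oplus>\<^bsub>K\<^esub> pairing \<delta> \<delta>' Y \<otimes>\<^bsub>K\<^esub> pairing e e Z
        \<oplus>\<^bsub>K\<^esub> (pairing \<delta> e Y \<otimes>\<^bsub>K\<^esub> pairing e \<delta>' Z \<oplus>\<^bsub>K\<^esub> pairing e \<delta>' Y \<otimes>\<^bsub>K\<^esub> pairing \<delta> e Z)"
    if "Y \<in> carrier HH.T" "Z \<in> carrier HH.T" for Y Z
    using that
  proof (induction rule: HH.tensor_induct)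
    case (pure m n)
    from pure(3,1,2) show ?case
      by (induction rule: HH.tensor_induct)
         (simp_all add: simps HH.mult_add_right K.l_distr K.r_distr K.m_ac K.a_ac)
  next
    case (add Y Y')
    then show ?case
      by (simp add: simps HH.mult_add_left K.l_distr K.r_distr K.a_ac)
  qed
  have "convolution \<delta> \<delta>' (u \<otimes>\<^bsub>H\<^esub> v) = pairing \<delta> \<delta>' (comult X u \<otimes>\<^bsub>HH.TA\<^esub> comult X v)"
    using u v by (simp add: convolution_def comult_mult)
  also have "\<dots> = e u \<otimes>\<^bsub>K\<^esub> convolution \<delta> \<delta>' v \<oplus>\<^bsub>K\<^esub> convolution \<delta> \<delta>' u \<otimes>\<^bsub>K\<^esub> e v
      \<oplus>\<^bsub>K\<^esub> (\<delta> u \<otimes>\<^bsub>K\<^esub> \<delta>' v \<oplus>\<^bsub>K\<^esub> \<delta>' u \<otimes>\<^bsub>K\<^esub> \<delta> v)"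
    using u v b by (simp add: expand convolution_def conv_e)
  finally show ?thesis by (simp add: e_def)
qed

lemma L_zero_closed [simp]: "\<zero>\<^bsub>L\<^esub> \<in> carrier L"
  by (simp add: L_iff bilinear_functionals_def)

lemma L_add_closed [simp]:
  assumes "\<delta> \<in> carrier L" "\<delta>' \<in> carrier L"
  shows "\<delta> \<oplus>\<^bsub>L\<^esub> \<delta>' \<in> carrier L"
proof -
  have "\<delta> \<oplus>\<^bsub>L\<^esub> \<delta>' \<in> bilinear_functionals"
    by (simp add: bilinear_functionals_def bilinear_functionalD[OF L_D(1)[OF assms(1)]]
        bilinear_functionalD[OF L_D(1)[OF assms(2)]] K.r_distr K.a_ac)
  then show ?thesis
    using assms by (simp add: L_iff[of "_ \<oplus>\<^bsub>L\<^esub> _"] L_D(3,4) K.l_distr K.r_distr K.a_ac)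
qed

lemma L_smult_closed [simp]:
  assumes "c \<in> carrier K" "\<delta> \<in> carrier L"
  shows "c \<odot>\<^bsub>L\<^esub> \<delta> \<in> carrier L"
proof -
  have "c \<odot>\<^bsub>L\<^esub> \<delta> \<in> bilinear_functionals"
    using assms(1)
    by (simp add: bilinear_functionals_def bilinear_functionalD[OF L_D(1)[OF assms(2)]] K.r_distr K.m_ac)
  then show ?thesis
    using assms by (simp add: L_iff[of "_ \<odot>\<^bsub>L\<^esub> _"] L_D(3,4) K.r_distr K.m_ac)
qed

lemma L_bracket_closed [simp]:
  assumes "\<delta> \<in> carrier L" "\<delta>' \<in> carrier L"
  shows "bracket L \<delta> \<delta>' \<in> carrier L"
proof -
  have c: "convolution \<delta> \<delta>' \<in> bilinear_functionals" "convolution \<delta>' \<delta> \<in> bilinear_functionals"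
    using assms L_D(1) convolution_bilinear by blast+
  note D = bilinear_functionalD[OF c(1)] bilinear_functionalD[OF c(2)]
  have "bracket L \<delta> \<delta>' \<in> bilinear_functionals"
    by (simp add: bilinear_functionals_def bracket_L D K.minus_eq K.minus_add K.r_distr K.r_minus K.a_ac)
  moreover have "bracket L \<delta> \<delta>' (u \<otimes>\<^bsub>H\<^esub> v)
      = x (\<epsilon> u) \<otimes>\<^bsub>K\<^esub> bracket L \<delta> \<delta>' v \<oplus>\<^bsub>K\<^esub> bracket L \<delta> \<delta>' u \<otimes>\<^bsub>K\<^esub> x (\<epsilon> v)"
    if "u \<in> carrier H" "v \<in> carrier H" for u v
  proof -
    have cancel: "a \<oplus>\<^bsub>K\<^esub> b \<oplus>\<^bsub>K\<^esub> (c \<oplus>\<^bsub>K\<^esub> d) \<ominus>\<^bsub>K\<^esub> (a' \<oplus>\<^bsub>K\<^esub> b' \<oplus>\<^bsub>K\<^esub> (d \<oplus>\<^bsub>K\<^esub> c)) = (a \<ominus>\<^bsub>K\<^esub> a') \<oplus>\<^bsub>K\<^esub> (b \<ominus>\<^bsub>K\<^esub> b')"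
      if "a \<in> carrier K" "b \<in> carrier K" "c \<in> carrier K" "d \<in> carrier K" "a' \<in> carrier K" "b' \<in> carrier K"
      for a b c d a' b'
      using that by algebra
    have distr: "c \<otimes>\<^bsub>K\<^esub> (a \<ominus>\<^bsub>K\<^esub> b) = c \<otimes>\<^bsub>K\<^esub> a \<ominus>\<^bsub>K\<^esub> c \<otimes>\<^bsub>K\<^esub> b" "(a \<ominus>\<^bsub>K\<^esub> b) \<otimes>\<^bsub>K\<^esub> c = a \<otimes>\<^bsub>K\<^esub> c \<ominus>\<^bsub>K\<^esub> b \<otimes>\<^bsub>K\<^esub> c"
      if "a \<in> carrier K" "b \<in> carrier K" "c \<in> carrier K" for a b c
      using that by algebra+
    show ?thesis
      using that assms by (simp add: bracket_L convolution_mult cancel distr D(1,5) L_D(3))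
  qed
  ultimately show ?thesis by (simp add: L_iff)
qed

lemma pairing_L_add:
  assumes "\<alpha> \<in> carrier L" "\<beta> \<in> carrier L" "\<gamma> \<in> carrier L" "Y \<in> carrier HH.T"
  shows "pairing \<alpha> (\<beta> \<oplus>\<^bsub>L\<^esub> \<gamma>) Y = pairing \<alpha> \<beta> Y \<oplus>\<^bsub>K\<^esub> pairing \<alpha> \<gamma> Y"
    and "pairing (\<beta> \<oplus>\<^bsub>L\<^esub> \<gamma>) \<alpha> Y = pairing \<beta> \<alpha> Y \<oplus>\<^bsub>K\<^esub> pairing \<gamma> \<alpha> Y"
  using assms(4)
  by (induction rule: HH.tensor_induct)
     (simp_all add: assms(1-3) L_D(1,3) K.r_distr K.l_distr K.a_ac)

lemma pairing_L_smult:
  assumes "\<alpha> \<in> carrier L" "\<beta> \<in> carrier L" "c \<in> carrier K" "Y \<in> carrier HH.T"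
  shows "pairing \<alpha> (c \<odot>\<^bsub>L\<^esub> \<beta>) Y = c \<otimes>\<^bsub>K\<^esub> pairing \<alpha> \<beta> Y"
    and "pairing (c \<odot>\<^bsub>L\<^esub> \<beta>) \<alpha> Y = c \<otimes>\<^bsub>K\<^esub> pairing \<beta> \<alpha> Y"
  using assms(4)
  by (induction rule: HH.tensor_induct)
     (simp_all add: assms(1-3) L_D(1,3) K.r_distr K.m_ac)

text \<open>The iterated commutator written out, with every product bracketed to the right. In the cyclic
  sum each of the six products then occurs once with either sign, which is the Jacobi identity.\<close>

lemma bracket_bracket:
  assumes a: "\<alpha> \<in> carrier L" and b: "\<beta> \<in> carrier L" and c: "\<gamma> \<in> carrier L" and u: "u \<in> carrier H"
  shows "bracket L \<alpha> (bracket L \<beta> \<gamma>) u =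
    convolution \<alpha> (convolution \<beta> \<gamma>) u \<ominus>\<^bsub>K\<^esub> convolution \<alpha> (convolution \<gamma> \<beta>) u
    \<ominus>\<^bsub>K\<^esub> (convolution \<beta> (convolution \<gamma> \<alpha>) u \<ominus>\<^bsub>K\<^esub> convolution \<gamma> (convolution \<beta> \<alpha>) u)"
proof -
  note L = L_D(1)[OF a] L_D(1)[OF b] L_D(1)[OF c] L_D(1)[OF L_bracket_closed[OF b c]]
  have "convolution \<alpha> (bracket L \<beta> \<gamma>) u
      = convolution \<alpha> (convolution \<beta> \<gamma>) u \<ominus>\<^bsub>K\<^esub> convolution \<alpha> (convolution \<gamma> \<beta>) u"
    unfolding convolution_def[of \<alpha>] using u L
    by (intro pairing_diff_right) (simp_all add: convolution_bilinear bracket_L)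
  moreover have "convolution (bracket L \<beta> \<gamma>) \<alpha> u
      = convolution (convolution \<beta> \<gamma>) \<alpha> u \<ominus>\<^bsub>K\<^esub> convolution (convolution \<gamma> \<beta>) \<alpha> u"
    unfolding convolution_def[of _ \<alpha>] using u L
    by (intro pairing_diff_left) (simp_all add: convolution_bilinear bracket_L)
  ultimately show ?thesis
    using u L by (simp add: bracket_L convolution_assoc)
qed

lemma L_abelian_group: "abelian_group L"
proof (rule abelian_groupI)
  show "\<exists>\<delta>' \<in> carrier L. \<delta>' \<oplus>\<^bsub>L\<^esub> \<delta> = \<zero>\<^bsub>L\<^esub>" if "\<delta> \<in> carrier L" for \<delta>
    using that
    by (intro bexI[of _ "(\<ominus>\<^bsub>K\<^esub> \<one>\<^bsub>K\<^esub>) \<odot>\<^bsub>L\<^esub> \<delta>"] L_eqI) (simp_all add: K.l_minus K.l_neg L_D(3))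
qed (auto simp: L_D K.a_ac intro!: L_eqI)

lemma isotropy_lie_algebra: "lie_algebra K L"
proof -
  have module: "module K L"
  proof (rule moduleI[OF K.is_cring L_abelian_group])
  qed (auto simp: L_D K.l_distr K.r_distr K.m_assoc intro!: L_eqI)
  interpret L: module K L by (rule module)
  have cl: "convolution \<alpha> \<beta> u \<in> carrier K"
    if "\<alpha> \<in> carrier L" "\<beta> \<in> carrier L" "u \<in> carrier H" for \<alpha> \<beta> u
    using that by (simp add: L_D(1))
  show ?thesis
  proof (intro lie_algebra.intro lie_algebra_axioms.intro field module)
    fix a b c assume a: "a \<in> carrier L" and b: "b \<in> carrier L" and c: "c \<in> carrier L"
    have diff_add: "p \<oplus>\<^bsub>K\<^esub> q \<ominus>\<^bsub>K\<^esub> (p' \<oplus>\<^bsub>K\<^esub> q') = (p \<ominus>\<^bsub>K\<^esub> p') \<oplus>\<^bsub>K\<^esub> (q \<ominus>\<^bsub>K\<^esub> q')"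
      if "p \<in> carrier K" "q \<in> carrier K" "p' \<in> carrier K" "q' \<in> carrier K" for p q p' q'
      using that by algebra
    show "bracket L (a \<oplus>\<^bsub>L\<^esub> b) c = bracket L a c \<oplus>\<^bsub>L\<^esub> bracket L b c"
      "bracket L a (b \<oplus>\<^bsub>L\<^esub> c) = bracket L a b \<oplus>\<^bsub>L\<^esub> bracket L a c"
      using a b c
      by (auto intro!: L_eqI simp: bracket_L convolution_def pairing_L_add diff_add L_D(1))
    show "bracket L a (bracket L b c) \<oplus>\<^bsub>L\<^esub> bracket L b (bracket L c a)
        \<oplus>\<^bsub>L\<^esub> bracket L c (bracket L a b) = \<zero>\<^bsub>L\<^esub>"
    proof (rule L_eqI)
      fix u assume u: "u \<in> carrier H"
      have cancel: "(p \<ominus>\<^bsub>K\<^esub> q \<ominus>\<^bsub>K\<^esub> (r \<ominus>\<^bsub>K\<^esub> v)) \<oplus>\<^bsub>K\<^esub> (r \<ominus>\<^bsub>K\<^esub> w \<ominus>\<^bsub>K\<^esub> (y \<ominus>\<^bsub>K\<^esub> q))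
          \<oplus>\<^bsub>K\<^esub> (y \<ominus>\<^bsub>K\<^esub> v \<ominus>\<^bsub>K\<^esub> (p \<ominus>\<^bsub>K\<^esub> w)) = \<zero>\<^bsub>K\<^esub>"
        if "p \<in> carrier K" "q \<in> carrier K" "r \<in> carrier K" "v \<in> carrier K" "w \<in> carrier K" "y \<in> carrier K"
        for p q r v w y
        using that by algebra
      show "(bracket L a (bracket L b c) \<oplus>\<^bsub>L\<^esub> bracket L b (bracket L c a)
        \<oplus>\<^bsub>L\<^esub> bracket L c (bracket L a b)) u = \<zero>\<^bsub>L\<^esub> u"
        using a b c u
        by (simp add: bracket_bracket cancel convolution_bilinear L_D(1))
    qed simp_all
  next
    fix r a b assume r: "r \<in> carrier K" and a: "a \<in> carrier L" and b: "b \<in> carrier L"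
    have diff_mult: "r \<otimes>\<^bsub>K\<^esub> p \<ominus>\<^bsub>K\<^esub> r \<otimes>\<^bsub>K\<^esub> q = r \<otimes>\<^bsub>K\<^esub> (p \<ominus>\<^bsub>K\<^esub> q)"
      if "p \<in> carrier K" "q \<in> carrier K" for p q
      using that r by algebra
    show "bracket L (r \<odot>\<^bsub>L\<^esub> a) b = r \<odot>\<^bsub>L\<^esub> bracket L a b"
      "bracket L a (r \<odot>\<^bsub>L\<^esub> b) = r \<odot>\<^bsub>L\<^esub> bracket L a b"
      using a b r
      by (auto intro!: L_eqI simp: bracket_L convolution_def pairing_L_smult diff_mult L_D(1))
  next
    fix a assume "a \<in> carrier L"
    then show "bracket L a a = \<zero>\<^bsub>L\<^esub>"
      by (auto intro!: L_eqI simp: bracket_L L_D(1) K.minus_eq K.r_neg)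
  qed (rule L_bracket_closed)
qed

text \<open>A lift is additive, so it may be computed from any expansion of \<open>\<Delta> u\<close> into pure tensors.\<close>

lemma bracket_sweedler:
  assumes "\<delta> \<in> carrier L" "\<delta>' \<in> carrier L" and u: "u \<in> carrier H"
    and "u\<^sub>1 \<in> {..<n} \<rightarrow> carrier H" "u\<^sub>2 \<in> {..<n} \<rightarrow> carrier H"
    and comult: "comult X u = (\<Oplus>\<^bsub>tensor2 X\<^esub>i \<in> {..<n::nat}. pure2 X (u\<^sub>1 i) (u\<^sub>2 i))"
  shows "bracket L \<delta> \<delta>' u
    = (\<Oplus>\<^bsub>K\<^esub>i \<in> {..<n}. \<delta> (u\<^sub>1 i) \<otimes>\<^bsub>K\<^esub> \<delta>' (u\<^sub>2 i) \<ominus>\<^bsub>K\<^esub> \<delta>' (u\<^sub>1 i) \<otimes>\<^bsub>K\<^esub> \<delta> (u\<^sub>2 i))"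
proof -
  interpret T2: cring "tensor2 X" unfolding tensor2_def by (rule HH.tensor_cring)
  have "pairing \<delta> \<delta>' (\<Oplus>\<^bsub>tensor2 X\<^esub>i \<in> {..<m}. pure2 X (u\<^sub>1 i) (u\<^sub>2 i))
      \<ominus>\<^bsub>K\<^esub> pairing \<delta>' \<delta> (\<Oplus>\<^bsub>tensor2 X\<^esub>i \<in> {..<m}. pure2 X (u\<^sub>1 i) (u\<^sub>2 i))
    = (\<Oplus>\<^bsub>K\<^esub>i \<in> {..<m}. \<delta> (u\<^sub>1 i) \<otimes>\<^bsub>K\<^esub> \<delta>' (u\<^sub>2 i) \<ominus>\<^bsub>K\<^esub> \<delta>' (u\<^sub>1 i) \<otimes>\<^bsub>K\<^esub> \<delta> (u\<^sub>2 i))"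
    if "m \<le> n" for m
    using that
  proof (induction m)
    case 0
    have "pairing \<alpha> \<beta> \<one>\<^bsub>HH.T\<^esub> = \<zero>\<^bsub>K\<^esub>" if "\<alpha> \<in> carrier L" "\<beta> \<in> carrier L" for \<alpha> \<beta>
      using pairing_add[OF L_D(1)[OF that(1)] L_D(1)[OF that(2)], of "\<one>\<^bsub>HH.T\<^esub>" "\<one>\<^bsub>HH.T\<^esub>"]
        pairing_closed[OF L_D(1)[OF that(1)] L_D(1)[OF that(2)], of "\<one>\<^bsub>HH.T\<^esub>"]
      by (simp add: K.add.l_cancel_one')
    then show ?case using assms(1,2) by (simp add: K.minus_eq)
  next
    case (Suc m)
    have el: "u\<^sub>1 i \<in> carrier H" "u\<^sub>2 i \<in> carrier H" if "i \<le> m" for i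
      using that Suc.prems assms(4,5) by (auto simp: Pi_iff)
    let ?Y = "\<Oplus>\<^bsub>tensor2 X\<^esub>i \<in> {..<m}. pure2 X (u\<^sub>1 i) (u\<^sub>2 i)"
    have Y: "?Y \<in> carrier HH.T"
      using T2.finsum_closed[of "\<lambda>i. pure2 X (u\<^sub>1 i) (u\<^sub>2 i)" "{..<m}"] el by (simp add: Pi_iff)
    have Suc_sum: "(\<Oplus>\<^bsub>tensor2 X\<^esub>i \<in> {..<Suc m}. pure2 X (u\<^sub>1 i) (u\<^sub>2 i)) = HH.pure (u\<^sub>1 m) (u\<^sub>2 m) \<otimes>\<^bsub>HH.T\<^esub> ?Y"
      using el by (subst lessThan_Suc, subst T2.finsum_insert) (auto simp: Pi_iff)
    have Suc_sum_K: "(\<Oplus>\<^bsub>K\<^esub>i \<in> {..<Suc m}. \<delta> (u\<^sub>1 i) \<otimes>\<^bsub>K\<^esub> \<delta>' (u\<^sub>2 i) \<ominus>\<^bsub>K\<^esub> \<delta>' (u\<^sub>1 i) \<otimes>\<^bsub>K\<^esub> \<delta> (u\<^sub>2 i))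
       = (\<delta> (u\<^sub>1 m) \<otimes>\<^bsub>K\<^esub> \<delta>' (u\<^sub>2 m) \<ominus>\<^bsub>K\<^esub> \<delta>' (u\<^sub>1 m) \<otimes>\<^bsub>K\<^esub> \<delta> (u\<^sub>2 m)) \<oplus>\<^bsub>K\<^esub>
         (\<Oplus>\<^bsub>K\<^esub>i \<in> {..<m}. \<delta> (u\<^sub>1 i) \<otimes>\<^bsub>K\<^esub> \<delta>' (u\<^sub>2 i) \<ominus>\<^bsub>K\<^esub> \<delta>' (u\<^sub>1 i) \<otimes>\<^bsub>K\<^esub> \<delta> (u\<^sub>2 i))"
      using el assms(1,2) by (subst lessThan_Suc, subst K.finsum_insert) (auto simp: Pi_iff L_D(3))
    have diff_add: "p \<oplus>\<^bsub>K\<^esub> q \<ominus>\<^bsub>K\<^esub> (p' \<oplus>\<^bsub>K\<^esub> q') = (p \<ominus>\<^bsub>K\<^esub> p') \<oplus>\<^bsub>K\<^esub> (q \<ominus>\<^bsub>K\<^esub> q')"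
      if "p \<in> carrier K" "q \<in> carrier K" "p' \<in> carrier K" "q' \<in> carrier K" for p q p' q'
      using that by algebra
    show ?case
      unfolding Suc_sum Suc_sum_K Suc.IH[OF Suc_leD[OF Suc.prems], symmetric]
      using Y el assms(1,2) by (simp add: L_D(1,3) diff_add del: tensor2_simps)
  qed
  then show ?thesis
    using u comult by (simp add: bracket_L convolution_def)
qed

section \<open>The isotropy Hopf algebra as a quotient of the total algebra\<close>

abbreviation "Kx \<equiv> algebra_via K x"
abbreviation "el \<equiv> isotropy_pure K X x"
abbreviation "B \<equiv> isotropy_algebra K X x"

lemma Kx_simps [simp]:
  "carrier Kx = carrier K" "add Kx = add K" "mult Kx = mult K" "one Kx = one K"
  "smult Kx a c = x a \<otimes>\<^bsub>K\<^esub> c"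
  by (simp_all add: algebra_via_def)

lemma Kx_algebra: "algebra A Kx"
  by (rule algebra_via_algebra[OF A.M_cring K.is_cring point_ring_hom])

sublocale KH: tensor_algebras A Kx "via_source X"
  unfolding tensor_algebras_def using Kx_algebra via_source_algebra ..

lemma isotropy_left_algebra: "algebra A (isotropy_left K X x)"
  unfolding isotropy_left_def
proof (rule algebra_via_algebra[OF A.M_cring KH.tensor_cring])
  show "(\<lambda>a. KH.pure \<one>\<^bsub>K\<^esub> (t a)) \<in> ring_hom A KH.TA"
    by (rule ring_hom_memI) (simp_all add: KH.pure_add_right[simplified])
qed

lemma isotropy_left_simps [simp]:
  "carrier (isotropy_left K X x) = carrier KH.T" "add (isotropy_left K X x) = mult KH.T"
  "mult (isotropy_left K X x) = mult KH.TA" "one (isotropy_left K X x) = KH.pure \<one>\<^bsub>K\<^esub> \<one>\<^bsub>H\<^esub>"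
  "smult (isotropy_left K X x) a Y = KH.pure \<one>\<^bsub>K\<^esub> (t a) \<otimes>\<^bsub>KH.TA\<^esub> Y"
  by (simp_all add: isotropy_left_def algebra_via_def KH.tensor_algebra_simps[simplified algebra_via_def])

sublocale KHK: tensor_algebras A "isotropy_left K X x" Kx
  unfolding tensor_algebras_def using isotropy_left_algebra Kx_algebra ..

lemma el_eq: "el c u d = KHK.pure (KH.pure c u) d"
  by (simp add: isotropy_pure_def)

lemma B_simps [simp]:
  "carrier B = carrier KHK.T" "add B = mult KHK.T" "zero B = one KHK.T"
  "mult B = mult KHK.TA" "one B = el \<one>\<^bsub>K\<^esub> \<one>\<^bsub>H\<^esub> \<one>\<^bsub>K\<^esub>"
  "smult B c z = el c \<one>\<^bsub>H\<^esub> \<one>\<^bsub>K\<^esub> \<otimes>\<^bsub>KHK.TA\<^esub> z"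
  using KHK.tensor_algebra_simps
  by (simp_all add: isotropy_algebra_def el_eq algebra_via_def[of "tensor_algebra _ _ _"])

context
  fixes c u d
  assumes cud: "c \<in> carrier K" "u \<in> carrier H" "d \<in> carrier K"
begin

lemma el_closed [simp]: "el c u d \<in> carrier KHK.T"
  using cud by (simp add: el_eq)

lemma el_add:
  "c' \<in> carrier K \<Longrightarrow> el (c \<oplus>\<^bsub>K\<^esub> c') u d = el c u d \<otimes>\<^bsub>KHK.T\<^esub> el c' u d"
  "u' \<in> carrier H \<Longrightarrow> el c (u \<oplus>\<^bsub>H\<^esub> u') d = el c u d \<otimes>\<^bsub>KHK.T\<^esub> el c u' d"
  "d' \<in> carrier K \<Longrightarrow> el c u (d \<oplus>\<^bsub>K\<^esub> d') = el c u d \<otimes>\<^bsub>KHK.T\<^esub> el c u d'"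
  using cud
  by (simp_all add: el_eq KH.pure_add_left[simplified] KH.pure_add_right[simplified]
      KHK.pure_add_left[simplified] KHK.pure_add_right[simplified])

lemma el_mult [simp]:
  "c' \<in> carrier K \<Longrightarrow> u' \<in> carrier H \<Longrightarrow> d' \<in> carrier K \<Longrightarrow>
    el c u d \<otimes>\<^bsub>KHK.TA\<^esub> el c' u' d' = el (c \<otimes>\<^bsub>K\<^esub> c') (u \<otimes>\<^bsub>H\<^esub> u') (d \<otimes>\<^bsub>K\<^esub> d')"
  using cud by (simp add: el_eq)

lemma el_source: "a \<in> carrier A \<Longrightarrow> el c (s a \<otimes>\<^bsub>H\<^esub> u) d = el (x a \<otimes>\<^bsub>K\<^esub> c) u d"
  using cud KH.pure_smult[of a c u] by (simp add: el_eq)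

lemma el_target: "a \<in> carrier A \<Longrightarrow> el c (t a \<otimes>\<^bsub>H\<^esub> u) d = el c u (x a \<otimes>\<^bsub>K\<^esub> d)"
  using cud KHK.pure_smult[of a "KH.pure c u" d] by (simp add: el_eq)

end

text \<open>The scalars \<open>d \<cdot> 1\<close> of \<open>A\<close> have the same image in \<open>H\<close> under \<open>s\<close> and \<open>t\<close>, so they move from one
  outer factor to the other. Hence the scalar multiplication by way of the left factor, which
  defines the \<open>K\<close>-algebra structure, agrees with the one by way of the right factor.\<close>

lemma el_scalar:
  assumes "c \<in> carrier K" "u \<in> carrier H" "d \<in> carrier K"
  shows "el c u d = el (c \<otimes>\<^bsub>K\<^esub> d) u \<one>\<^bsub>K\<^esub>"
proof -
  have "s (d \<odot>\<^bsub>A\<^esub> \<one>\<^bsub>A\<^esub>) = t (d \<odot>\<^bsub>A\<^esub> \<one>\<^bsub>A\<^esub>)"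
    using assms by (simp add: source_smult target_smult)
  then show ?thesis
    using el_source[of c u "\<one>\<^bsub>K\<^esub>" "d \<odot>\<^bsub>A\<^esub> \<one>\<^bsub>A\<^esub>"] el_target[of c u "\<one>\<^bsub>K\<^esub>" "d \<odot>\<^bsub>A\<^esub> \<one>\<^bsub>A\<^esub>"] assms
    by (simp add: point_scalar K.m_comm)
qed

lemma B_algebra: "algebra K B"
proof -
  have "algebra K (algebra_via KHK.TA (\<lambda>c. el c \<one>\<^bsub>H\<^esub> \<one>\<^bsub>K\<^esub>))"
  proof (rule algebra_via_algebra[OF K.is_cring KHK.tensor_cring])
    show "(\<lambda>c. el c \<one>\<^bsub>H\<^esub> \<one>\<^bsub>K\<^esub>) \<in> ring_hom K KHK.TA"
      by (rule ring_hom_memI) (simp_all add: el_add, simp add: el_eq)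
  qed
  then show ?thesis by (simp add: isotropy_algebra_def)
qed

sublocale BB: tensor_algebras K B B
  unfolding tensor_algebras_def using B_algebra B_algebra ..

text \<open>The map \<open>u \<mapsto> 1 \<otimes> u \<otimes> 1\<close> presents the isotropy Hopf algebra as a quotient of \<open>H\<close>. As it is
  surjective and compatible with products, counits and comultiplications, identities between functionals on the
  isotropy Hopf algebra can be checked on \<open>H\<close>.\<close>

definition proj :: "'h \<Rightarrow> ('k, 'h) isotropy"
  where "proj u = el \<one>\<^bsub>K\<^esub> u \<one>\<^bsub>K\<^esub>"

lemma proj_closed [simp]: "u \<in> carrier H \<Longrightarrow> proj u \<in> carrier KHK.T"
  by (simp add: proj_def)

lemma proj_add: "u \<in> carrier H \<Longrightarrow> v \<in> carrier H \<Longrightarrow> proj (u \<oplus>\<^bsub>H\<^esub> v) = proj u \<otimes>\<^bsub>KHK.T\<^esub> proj v"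
  by (simp add: proj_def el_add)

lemma proj_mult: "u \<in> carrier H \<Longrightarrow> v \<in> carrier H \<Longrightarrow> proj (u \<otimes>\<^bsub>H\<^esub> v) = proj u \<otimes>\<^bsub>KHK.TA\<^esub> proj v"
  by (simp add: proj_def)

lemma proj_source: "a \<in> carrier A \<Longrightarrow> u \<in> carrier H \<Longrightarrow> proj (s a \<otimes>\<^bsub>H\<^esub> u) = x a \<odot>\<^bsub>B\<^esub> proj u"
  by (simp add: proj_def el_source)

lemma proj_target: "a \<in> carrier A \<Longrightarrow> u \<in> carrier H \<Longrightarrow> proj (t a \<otimes>\<^bsub>H\<^esub> u) = x a \<odot>\<^bsub>B\<^esub> proj u"
  by (simp add: proj_def el_target el_scalar[of "\<one>\<^bsub>K\<^esub>" u "x a"])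

lemma proj_smult: "c \<in> carrier K \<Longrightarrow> u \<in> carrier H \<Longrightarrow> proj (c \<odot>\<^bsub>H\<^esub> u) = c \<odot>\<^bsub>B\<^esub> proj u"
  using proj_source[of "c \<odot>\<^bsub>A\<^esub> \<one>\<^bsub>A\<^esub>" u] by (simp add: smult_eq_source point_scalar)

lemma el_eq_proj:
  assumes "c \<in> carrier K" "u \<in> carrier H" "d \<in> carrier K"
  shows "el c u d = proj ((c \<otimes>\<^bsub>K\<^esub> d) \<odot>\<^bsub>H\<^esub> u)"
proof -
  have "el c u d = (c \<otimes>\<^bsub>K\<^esub> d) \<odot>\<^bsub>B\<^esub> proj u"
    using assms by (simp add: el_scalar[of c u d] proj_def)
  then show ?thesis using assms by (simp add: proj_smult del: B_simps)
qed

text \<open>Scalars in the outer factors can be absorbed by \<open>u\<close>, so every \<open>c \<otimes> u \<otimes> d\<close> is in the image, and so are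
  sums of such elements.\<close>

lemma proj_surj:
  assumes "z \<in> carrier KHK.T"
  shows "\<exists>u \<in> carrier H. z = proj u"
  using assms
proof (induction rule: KHK.tensor_induct)
  case (pure Y d)
  have Y: "Y \<in> carrier KH.T" using pure by simp
  have d: "d \<in> carrier K" using pure by simp
  from Y show ?case
  proof (induction rule: KH.tensor_induct)
    case (pure c u)
    then show ?case
      using d el_eq_proj[of c u d] by (auto simp: el_eq intro!: bexI[of _ "(c \<otimes>\<^bsub>K\<^esub> d) \<odot>\<^bsub>H\<^esub> u"])
  next
    case (add Y Z)
    then obtain u v where "u \<in> carrier H" "v \<in> carrier H"
      "KHK.pure Y d = proj u" "KHK.pure Z d = proj v" by blast
    then show ?case
      using add(1,2) d by (intro bexI[of _ "u \<oplus>\<^bsub>H\<^esub> v"]) (simp_all add: proj_add KHK.pure_add_left[simplified])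
  qed
next
  case (add z z')
  then obtain u v where "u \<in> carrier H" "v \<in> carrier H" "z = proj u" "z' = proj v" by blast
  then show ?case
    by (intro bexI[of _ "u \<oplus>\<^bsub>H\<^esub> v"]) (simp_all add: proj_add)
qed

text \<open>The condition under which \<open>f\<close> defines an additive map on \<open>K\<^sub>x \<otimes>\<^sub>A H \<otimes>\<^sub>A K\<^sub>x\<close>.\<close>

definition balanced3 :: "('g, 'y) monoid_scheme \<Rightarrow> ('k \<Rightarrow> 'h \<Rightarrow> 'k \<Rightarrow> 'g) \<Rightarrow> bool"
  where "balanced3 G f \<longleftrightarrow> (\<forall>c \<in> carrier K. \<forall>u \<in> carrier H. \<forall>d \<in> carrier K.
      f c u d \<in> carrier G
    \<and> (\<forall>c' \<in> carrier K. f (c \<oplus>\<^bsub>K\<^esub> c') u d = f c u d \<otimes>\<^bsub>G\<^esub> f c' u d)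
    \<and> (\<forall>u' \<in> carrier H. f c (u \<oplus>\<^bsub>H\<^esub> u') d = f c u d \<otimes>\<^bsub>G\<^esub> f c u' d)
    \<and> (\<forall>d' \<in> carrier K. f c u (d \<oplus>\<^bsub>K\<^esub> d') = f c u d \<otimes>\<^bsub>G\<^esub> f c u d')
    \<and> (\<forall>a \<in> carrier A. f (x a \<otimes>\<^bsub>K\<^esub> c) u d = f c (s a \<otimes>\<^bsub>H\<^esub> u) d)
    \<and> (\<forall>a \<in> carrier A. f c (t a \<otimes>\<^bsub>H\<^esub> u) d = f c u (x a \<otimes>\<^bsub>K\<^esub> d)))"

lemma isotropy_lift_el:
  assumes G: "comm_group G" and f: "balanced3 G f"
    and cud: "c \<in> carrier K" "u \<in> carrier H" "d \<in> carrier K"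
  shows "isotropy_lift G f (el c u d) = f c u d"
proof -
  interpret G: comm_group G by (rule G)
  define F where "F = (\<lambda>Y d. tensor_lift G (\<lambda>c u. f c u d) Y)"
  have bal: "balanced A Kx (via_source X) G (\<lambda>c u. f c u d)" if "d \<in> carrier K" for d
    using f that by (simp add: balanced_def balanced3_def)
  have F_pure: "F (KH.pure c u) d = f c u d"
    if "c \<in> carrier K" "u \<in> carrier H" "d \<in> carrier K" for c u d
    using that KH.lift_pure[OF G bal] by (simp add: F_def)
  have F_closed: "F Y d \<in> carrier G" if "Y \<in> carrier KH.T" "d \<in> carrier K" for Y d
    using that KH.lift_closed[OF G bal] by (simp add: F_def)
  have F_add: "F (Y \<otimes>\<^bsub>KH.T\<^esub> Z) d = F Y d \<otimes>\<^bsub>G\<^esub> F Z d"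
    if "Y \<in> carrier KH.T" "Z \<in> carrier KH.T" "d \<in> carrier K" for Y Z d
    using that KH.lift_mult[OF G bal] by (simp add: F_def)
  note f' = f[unfolded balanced3_def, rule_format]
  have "F Y (d \<oplus>\<^bsub>K\<^esub> d') = F Y d \<otimes>\<^bsub>G\<^esub> F Y d'"
    if "Y \<in> carrier KH.T" "d \<in> carrier K" "d' \<in> carrier K" for Y d d'
    using that by (induction rule: KH.tensor_induct) (simp_all add: F_pure F_add F_closed f' G.m_ac)
  moreover have "F (KH.pure \<one>\<^bsub>K\<^esub> (t a) \<otimes>\<^bsub>KH.TA\<^esub> Y) d = F Y (x a \<otimes>\<^bsub>K\<^esub> d)"
    if "Y \<in> carrier KH.T" "d \<in> carrier K" "a \<in> carrier A" for Y d a
    using that by (induction rule: KH.tensor_induct) (simp_all add: F_pure F_add KH.mult_add_right f')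
  ultimately have "balanced A (isotropy_left K X x) Kx G F"
    by (simp add: balanced_def F_add F_closed)
  then show ?thesis
    using cud KHK.lift_pure[OF G, of F "KH.pure c u" d]
    by (simp add: isotropy_lift_def el_eq F_pure flip: F_def)
qed

section \<open>The isomorphism of Lie algebras\<close>

abbreviation "Hopf \<equiv> isotropy_hopf K X x"
abbreviation "L' \<equiv> hopf_lie K Hopf"

definition functional_lift :: "('h \<Rightarrow> 'k) \<Rightarrow> ('k, 'h) isotropy \<Rightarrow> 'k"
  where "functional_lift \<alpha> = isotropy_lift (add_monoid K) (\<lambda>c u d. c \<otimes>\<^bsub>K\<^esub> \<alpha> u \<otimes>\<^bsub>K\<^esub> d)"

text \<open>Bilinearity of \<open>\<alpha>\<close> is exactly what makes \<open>c \<otimes> u \<otimes> d \<mapsto> c * \<alpha> u * d\<close> well defined. For \<open>\<alpha> = x \<circ> \<epsilon>\<close>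
  this is the counit of the isotropy Hopf algebra.\<close>

lemma functional_lift_proj [simp]:
  assumes "\<alpha> \<in> bilinear_functionals" "u \<in> carrier H"
  shows "functional_lift \<alpha> (proj u) = \<alpha> u"
proof -
  have "balanced3 (add_monoid K) (\<lambda>c u d. c \<otimes>\<^bsub>K\<^esub> \<alpha> u \<otimes>\<^bsub>K\<^esub> d)"
    by (simp add: balanced3_def bilinear_functionalD[OF assms(1)] K.l_distr K.r_distr K.m_ac)
  then show ?thesis
    using assms bilinear_functionalD(1)[OF assms]
    by (simp add: functional_lift_def proj_def isotropy_lift_el[OF K.a_comm_group])
qed

lemma Hopf_simps:
  "Alg Hopf = B" "hopf_counit Hopf = functional_lift (\<lambda>u. x (\<epsilon> u))"
  "hopf_comult Hopf = isotropy_lift (add_monoid BB.TA) (\<lambda>c u d. tensor_lift (add_monoid BB.TA)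
    (\<lambda>u\<^sub>1 u\<^sub>2. BB.pure (el c u\<^sub>1 \<one>\<^bsub>K\<^esub>) (el \<one>\<^bsub>K\<^esub> u\<^sub>2 d)) (comult X u))"
  by (simp_all only: isotropy_hopf_def Let_def hopf_data.simps functional_lift_def)

lemma counit_proj: "u \<in> carrier H \<Longrightarrow> hopf_counit Hopf (proj u) = x (\<epsilon> u)"
  by (simp add: Hopf_simps counit_bilinear_functional)

text \<open>In the isotropy algebra \<open>t a\<close> in the left factor and \<open>s a\<close> in the right factor both amount to the scalar
  \<open>x a\<close>, which moves across the tensor product over \<open>K\<close>.\<close>

lemma balanced_el_el:
  assumes "c \<in> carrier K" "d \<in> carrier K"
  shows "balanced A (via_target X) (via_source X) (add_monoid BB.TA)
    (\<lambda>u v. BB.pure (el c u \<one>\<^bsub>K\<^esub>) (el \<one>\<^bsub>K\<^esub> v d))"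
proof -
  have "BB.pure (el c (t a \<otimes>\<^bsub>H\<^esub> u) \<one>\<^bsub>K\<^esub>) (el \<one>\<^bsub>K\<^esub> v d) = BB.pure (el c u \<one>\<^bsub>K\<^esub>) (el \<one>\<^bsub>K\<^esub> (s a \<otimes>\<^bsub>H\<^esub> v) d)"
    if "a \<in> carrier A" "u \<in> carrier H" "v \<in> carrier H" for a u v
    using that assms BB.pure_smult[of "x a" "el c u \<one>\<^bsub>K\<^esub>" "el \<one>\<^bsub>K\<^esub> v d"]
    by (simp add: el_source el_target el_scalar[of c u "x a"] K.m_comm)
  then show ?thesis
    using assms
    by (simp add: balanced_def el_add BB.pure_add_left[simplified] BB.pure_add_right[simplified])
qed

text \<open>The comultiplication of the isotropy Hopf algebra is a lift of a lift. The inner lift, as a function of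
  \<open>c\<close>, \<open>u\<close> and \<open>d\<close>, may be lifted again because \<open>\<Delta>\<close> is \<open>A\<close>-bilinear.\<close>

lemma comult_proj:
  assumes u: "u \<in> carrier H"
  shows "hopf_comult Hopf (proj u)
    = tensor_lift (add_monoid BB.TA) (\<lambda>u\<^sub>1 u\<^sub>2. BB.pure (proj u\<^sub>1) (proj u\<^sub>2)) (comult X u)"
proof -
  let ?G = "add_monoid BB.TA"
  note G = BB.comm_group_add_tensor
  define g where "g = (\<lambda>c d. tensor_lift ?G (\<lambda>u v. BB.pure (el c u \<one>\<^bsub>K\<^esub>) (el \<one>\<^bsub>K\<^esub> v d)))"
  have g_pure: "g c d (HH.pure u v) = BB.pure (el c u \<one>\<^bsub>K\<^esub>) (el \<one>\<^bsub>K\<^esub> v d)"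
    if "c \<in> carrier K" "d \<in> carrier K" "u \<in> carrier H" "v \<in> carrier H" for c d u v
    using that HH.lift_pure[OF G balanced_el_el] by (simp add: g_def)
  have g_closed: "g c d Y \<in> carrier BB.T"
    if "c \<in> carrier K" "d \<in> carrier K" "Y \<in> carrier HH.T" for c d Y
    using that HH.lift_closed[OF G balanced_el_el] by (simp add: g_def)
  have g_add: "g c d (Y \<otimes>\<^bsub>HH.T\<^esub> Z) = g c d Y \<otimes>\<^bsub>BB.T\<^esub> g c d Z"
    if "c \<in> carrier K" "d \<in> carrier K" "Y \<in> carrier HH.T" "Z \<in> carrier HH.T" for c d Y Z
    using that HH.lift_mult[OF G balanced_el_el] by (simp add: g_def)
  note g = g_pure g_closed g_add BB.T.m_ac HH.mult_add_right
    BB.pure_add_left[simplified] BB.pure_add_right[simplified]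
  have "g (c \<oplus>\<^bsub>K\<^esub> c') d Y = g c d Y \<otimes>\<^bsub>BB.T\<^esub> g c' d Y"
    if "Y \<in> carrier HH.T" "c \<in> carrier K" "c' \<in> carrier K" "d \<in> carrier K" for c c' d Y
    using that by (induction rule: HH.tensor_induct) (simp_all add: g el_add)
  moreover have "g c (d \<oplus>\<^bsub>K\<^esub> d') Y = g c d Y \<otimes>\<^bsub>BB.T\<^esub> g c d' Y"
    if "Y \<in> carrier HH.T" "c \<in> carrier K" "d \<in> carrier K" "d' \<in> carrier K" for c d d' Y
    using that by (induction rule: HH.tensor_induct) (simp_all add: g el_add)
  moreover have "g c d (HH.pure (s a) \<one>\<^bsub>H\<^esub> \<otimes>\<^bsub>HH.TA\<^esub> Y) = g (x a \<otimes>\<^bsub>K\<^esub> c) d Y"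
    if "Y \<in> carrier HH.T" "c \<in> carrier K" "d \<in> carrier K" "a \<in> carrier A" for c d a Y
    using that by (induction rule: HH.tensor_induct) (simp_all add: g el_source)
  moreover have "g c d (HH.pure \<one>\<^bsub>H\<^esub> (t a) \<otimes>\<^bsub>HH.TA\<^esub> Y) = g c (x a \<otimes>\<^bsub>K\<^esub> d) Y"
    if "Y \<in> carrier HH.T" "c \<in> carrier K" "d \<in> carrier K" "a \<in> carrier A" for c d a Y
    using that by (induction rule: HH.tensor_induct) (simp_all add: g el_target)
  ultimately have "balanced3 ?G (\<lambda>c u d. g c d (comult X u))"
    by (simp add: balanced3_def g_closed g_add comult_source comult_target)
  from isotropy_lift_el[OF G this, of "\<one>\<^bsub>K\<^esub>" u "\<one>\<^bsub>K\<^esub>"] u show ?thesis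
    by (simp add: Hopf_simps g_def proj_def)
qed

text \<open>By surjectivity of \<open>proj\<close> the conditions on a derivation need to be tested on \<open>proj u\<close> only, where
  the counit is \<open>x (\<epsilon> u)\<close>.\<close>

lemma L'_iff:
  "\<gamma> \<in> carrier L' \<longleftrightarrow> \<gamma> \<in> carrier KHK.T \<rightarrow>\<^sub>E carrier K
    \<and> (\<forall>u \<in> carrier H. \<forall>v \<in> carrier H. \<gamma> (proj (u \<oplus>\<^bsub>H\<^esub> v)) = \<gamma> (proj u) \<oplus>\<^bsub>K\<^esub> \<gamma> (proj v))
    \<and> (\<forall>c \<in> carrier K. \<forall>u \<in> carrier H. \<gamma> (c \<odot>\<^bsub>B\<^esub> proj u) = c \<otimes>\<^bsub>K\<^esub> \<gamma> (proj u))
    \<and> (\<forall>u \<in> carrier H. \<forall>v \<in> carrier H.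
         \<gamma> (proj (u \<otimes>\<^bsub>H\<^esub> v)) = x (\<epsilon> u) \<otimes>\<^bsub>K\<^esub> \<gamma> (proj v) \<oplus>\<^bsub>K\<^esub> \<gamma> (proj u) \<otimes>\<^bsub>K\<^esub> x (\<epsilon> v))"
proof -
  have all: "(\<forall>z \<in> carrier KHK.T. P z) \<longleftrightarrow> (\<forall>u \<in> carrier H. P (proj u))" for P
    using proj_surj by (metis proj_closed)
  show ?thesis
    by (simp add: hopf_lie_def derivations_def Hopf_simps(1) all proj_add proj_mult counit_proj)
qed

lemma L'_eqI:
  assumes "\<gamma> \<in> extensional (carrier KHK.T)" "\<gamma>' \<in> extensional (carrier KHK.T)"
    and "\<And>u. u \<in> carrier H \<Longrightarrow> \<gamma> (proj u) = \<gamma>' (proj u)"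
  shows "\<gamma> = \<gamma>'"
  using assms(1,2) proj_surj assms(3) by (metis extensionalityI)

lemma L'_apply [simp]:
  assumes "u \<in> carrier H"
  shows "\<zero>\<^bsub>L'\<^esub> (proj u) = \<zero>\<^bsub>K\<^esub>" "(\<gamma> \<oplus>\<^bsub>L'\<^esub> \<gamma>') (proj u) = \<gamma> (proj u) \<oplus>\<^bsub>K\<^esub> \<gamma>' (proj u)"
    "(c \<odot>\<^bsub>L'\<^esub> \<gamma>) (proj u) = c \<otimes>\<^bsub>K\<^esub> \<gamma> (proj u)"
  using assms by (simp_all add: hopf_lie_def Hopf_simps(1))

lemma L'_extensional [simp]:
  "\<zero>\<^bsub>L'\<^esub> \<in> extensional (carrier KHK.T)" "\<gamma> \<oplus>\<^bsub>L'\<^esub> \<gamma>' \<in> extensional (carrier KHK.T)"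
  "c \<odot>\<^bsub>L'\<^esub> \<gamma> \<in> extensional (carrier KHK.T)" "bracket L' \<gamma> \<gamma>' \<in> extensional (carrier KHK.T)"
  by (simp_all add: hopf_lie_def bracket_convolution_lie Hopf_simps(1))

text \<open>The bracket on the side of the isotropy Hopf algebra, pulled back along \<open>proj\<close>, is computed by
  the comultiplication of \<open>H\<close>.\<close>

lemma pairing_comult_proj:
  assumes \<gamma>: "\<gamma> \<in> carrier L'" and \<gamma>': "\<gamma>' \<in> carrier L'" and u: "u \<in> carrier H"
  shows "tensor_lift (add_monoid K) (\<lambda>z z'. \<gamma> z \<otimes>\<^bsub>K\<^esub> \<gamma>' z') (hopf_comult Hopf (proj u))
    = pairing (\<lambda>u. \<gamma> (proj u)) (\<lambda>u. \<gamma>' (proj u)) (comult X u)"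
proof -
  let ?h = "tensor_lift (add_monoid K) (\<lambda>z z'. \<gamma> z \<otimes>\<^bsub>K\<^esub> \<gamma>' z')"
  have closed: "\<gamma> z \<in> carrier K" "\<gamma>' z \<in> carrier K" if "z \<in> carrier KHK.T" for z
    using \<gamma> \<gamma>' that by (auto simp: L'_iff)
  have linear: "\<chi> (z \<otimes>\<^bsub>KHK.T\<^esub> z') = \<chi> z \<oplus>\<^bsub>K\<^esub> \<chi> z'" "c \<in> carrier K \<Longrightarrow> \<chi> (c \<odot>\<^bsub>B\<^esub> z) = c \<otimes>\<^bsub>K\<^esub> \<chi> z"
    if "\<chi> \<in> carrier L'" "z \<in> carrier KHK.T" "z' \<in> carrier KHK.T" for \<chi> c z z'
    using that by (simp_all add: hopf_lie_def derivations_def Hopf_simps(1) del: B_simps(6))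
  have bal: "balanced K B B (add_monoid K) (\<lambda>z z'. \<gamma> z \<otimes>\<^bsub>K\<^esub> \<gamma>' z')"
    by (simp add: balanced_def closed linear[OF \<gamma>] linear[OF \<gamma>'] K.l_distr K.r_distr K.m_ac del: B_simps(6))
  have h: "?h \<in> hom (add_monoid BB.TA) (add_monoid K)"
    using BB.lift_hom[OF K.a_comm_group bal] by (simp add: hom_def)
  have bal': "balanced A (via_target X) (via_source X) (add_monoid BB.TA) (\<lambda>u v. BB.pure (proj u) (proj v))"
    using balanced_el_el[of "\<one>\<^bsub>K\<^esub>" "\<one>\<^bsub>K\<^esub>"] by (simp add: proj_def)
  have "?h (hopf_comult Hopf (proj u)) = tensor_lift (add_monoid K) (\<lambda>u v. ?h (BB.pure (proj u) (proj v))) (comult X u)"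
    unfolding comult_proj[OF u]
    using u by (intro HH.lift_comp[OF BB.comm_group_add_tensor bal' K.a_comm_group h]) simp
  also have "\<dots> = pairing (\<lambda>u. \<gamma> (proj u)) (\<lambda>u. \<gamma>' (proj u)) (comult X u)"
  proof (rule HH.lift_cong[OF K.a_comm_group, symmetric])
    show "balanced A (via_target X) (via_source X) (add_monoid K) (\<lambda>u v. ?h (BB.pure (proj u) (proj v)))"
      by (rule HH.balanced_comp[OF BB.comm_group_add_tensor bal' h])
  qed (use u in \<open>simp_all add: BB.lift_pure[OF K.a_comm_group bal]\<close>)
  finally show ?thesis .
qed

definition nabla :: "('h \<Rightarrow> 'k) \<Rightarrow> ('k, 'h) isotropy \<Rightarrow> 'k"
  where "nabla \<delta> = restrict (functional_lift \<delta>) (carrier KHK.T)"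

lemma nabla_proj [simp]: "\<delta> \<in> carrier L \<Longrightarrow> u \<in> carrier H \<Longrightarrow> nabla \<delta> (proj u) = \<delta> u"
  by (simp add: nabla_def L_D(1))

lemma nabla_extensional [simp]: "nabla \<delta> \<in> extensional (carrier KHK.T)"
  by (simp add: nabla_def)

lemma nabla_closed:
  assumes \<delta>: "\<delta> \<in> carrier L"
  shows "nabla \<delta> \<in> carrier L'"
proof -
  have "nabla \<delta> z \<in> carrier K" if z: "z \<in> carrier KHK.T" for z
    using proj_surj[OF z] \<delta> by (auto simp: L_D(3))
  moreover have "nabla \<delta> (c \<odot>\<^bsub>B\<^esub> proj u) = c \<otimes>\<^bsub>K\<^esub> nabla \<delta> (proj u)"
    if "c \<in> carrier K" "u \<in> carrier H" for c u
    using that \<delta> bilinear_functional_smult[OF L_D(1)[OF \<delta>] that]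
    by (simp add: proj_smult[symmetric] del: B_simps)
  ultimately show ?thesis
    using \<delta> bilinear_functionalD(2)[OF L_D(1)[OF \<delta>]]
    by (simp add: L'_iff PiE_iff L_D(4) del: B_simps)
qed

lemma comp_proj_closed:
  assumes \<gamma>: "\<gamma> \<in> carrier L'"
  shows "(\<lambda>u \<in> carrier H. \<gamma> (proj u)) \<in> carrier L"
proof -
  have "\<gamma> (proj u) \<in> carrier K" if "u \<in> carrier H" for u
    using \<gamma> that by (auto simp: L'_iff)
  then show ?thesis
    using \<gamma> 
    by (simp add: L_iff bilinear_functionals_def L'_iff proj_source proj_target del: B_simps)
qed

text \<open>The inverse is composition with \<open>proj\<close>, and compatibility with the operations is checked on the
  elements \<open>proj u\<close>.\<close>

lemma nabla_iso: "nabla \<in> lie_isos K L L'"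
proof -
  have "bij_betw nabla (carrier L) (carrier L')"
  proof (rule bij_betw_byWitness)
    show "\<forall>\<delta> \<in> carrier L. (\<lambda>u \<in> carrier H. nabla \<delta> (proj u)) = \<delta>"
      by (auto intro!: L_eqI simp: L_D(2))
    show "\<forall>\<gamma> \<in> carrier L'. nabla (\<lambda>u \<in> carrier H. \<gamma> (proj u)) = \<gamma>"
    proof
      fix \<gamma> assume \<gamma>: "\<gamma> \<in> carrier L'"
      then have "\<gamma> \<in> extensional (carrier KHK.T)" by (simp add: L'_iff PiE_iff)
      then show "nabla (\<lambda>u \<in> carrier H. \<gamma> (proj u)) = \<gamma>"
        using comp_proj_closed[OF \<gamma>] by (intro L'_eqI) simp_all
    qed
  qed (use nabla_closed comp_proj_closed in blast)+
  moreover have "nabla (bracket L \<delta> \<delta>') = bracket L' (nabla \<delta>) (nabla \<delta>')"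
    if \<delta>: "\<delta> \<in> carrier L" and \<delta>': "\<delta>' \<in> carrier L" for \<delta> \<delta>'
  proof (rule L'_eqI)
    fix u assume u: "u \<in> carrier H"
    have eq: "pairing (\<lambda>u. nabla \<alpha> (proj u)) (\<lambda>u. nabla \<beta> (proj u)) (comult X u) = convolution \<alpha> \<beta> u"
      if "\<alpha> \<in> carrier L" "\<beta> \<in> carrier L" for \<alpha> \<beta>
      unfolding convolution_def using that u by (intro pairing_cong) (simp_all add: L_D(1))
    have "bracket L' (nabla \<delta>) (nabla \<delta>') (proj u) = convolution \<delta> \<delta>' u \<ominus>\<^bsub>K\<^esub> convolution \<delta>' \<delta> u"
      unfolding hopf_lie_def[of K Hopf] bracket_convolution_lie
      using u \<delta> \<delta>' by (simp add: Hopf_simps(1) pairing_comult_proj nabla_closed eq)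
    then show "nabla (bracket L \<delta> \<delta>') (proj u) = bracket L' (nabla \<delta>) (nabla \<delta>') (proj u)"
      using u \<delta> \<delta>' by (simp add: bracket_L)
  qed simp_all
  ultimately show ?thesis
    by (auto simp: lie_isos_def intro!: L'_eqI)
qed

end

theorem proposition9p1:
  fixes K :: "('k, 'q) ring_scheme"
    and X :: "('k, 'a, 'h, 'z) hopf_algebroid_data_scheme"
  assumes "hopf_algebroid K X"
    and "points K (Base X) \<noteq> {}"
  shows "\<forall>x \<in> points K (Base X).
      lie_algebra K (isotropy_lie K X x)
    \<and> (\<forall>\<delta> \<in> carrier (isotropy_lie K X x). \<forall>\<delta>' \<in> carrier (isotropy_lie K X x).
         \<forall>u \<in> carrier (Total X). \<forall>(n::nat) u\<^sub>1 u\<^sub>2.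
           u\<^sub>1 \<in> {..<n} \<rightarrow> carrier (Total X) \<and> u\<^sub>2 \<in> {..<n} \<rightarrow> carrier (Total X)
           \<and> comult X u = (\<Oplus>\<^bsub>tensor2 X\<^esub>i \<in> {..<n}. pure2 X (u\<^sub>1 i) (u\<^sub>2 i)) \<longrightarrow>
           bracket (isotropy_lie K X x) \<delta> \<delta>' u =
             (\<Oplus>\<^bsub>K\<^esub>i \<in> {..<n}. \<delta> (u\<^sub>1 i) \<otimes>\<^bsub>K\<^esub> \<delta>' (u\<^sub>2 i) \<ominus>\<^bsub>K\<^esub> \<delta>' (u\<^sub>1 i) \<otimes>\<^bsub>K\<^esub> \<delta> (u\<^sub>2 i)))
    \<and> lie_algebra K (hopf_lie K (isotropy_hopf K X x))
    \<and> (\<exists>\<phi> \<in> lie_isos K (isotropy_lie K X x) (hopf_lie K (isotropy_hopf K X x)).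
         \<forall>\<delta> \<in> carrier (isotropy_lie K X x). \<forall>u \<in> carrier (Total X).
           \<phi> \<delta> (isotropy_pure K X x \<one>\<^bsub>K\<^esub> u \<one>\<^bsub>K\<^esub>) = \<delta> u)"
proof
  fix x assume x: "x \<in> points K (Base X)"
  interpret pointed_hopf_algebroid K X x
    using assms(1) x by (simp add: pointed_hopf_algebroid_def pointed_hopf_algebroid_axioms_def)
  have "nabla \<zero>\<^bsub>L\<^esub> = \<zero>\<^bsub>L'\<^esub>"
    by (rule L'_eqI) simp_all
  then have "lie_algebra K L'"
    by (rule lie_algebra_transport[OF isotropy_lie_algebra nabla_iso])
  moreover have "\<exists>\<phi> \<in> lie_isos K L L'. \<forall>\<delta> \<in> carrier L. \<forall>u \<in> carrier H. \<phi> \<delta> (el \<one>\<^bsub>K\<^esub> u \<one>\<^bsub>K\<^esub>) = \<delta> u"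
    using nabla_iso nabla_proj by (auto simp: proj_def)
  ultimately show "lie_algebra K L
    \<and> (\<forall>\<delta> \<in> carrier L. \<forall>\<delta>' \<in> carrier L.
         \<forall>u \<in> carrier H. \<forall>(n::nat) u\<^sub>1 u\<^sub>2.
           u\<^sub>1 \<in> {..<n} \<rightarrow> carrier H \<and> u\<^sub>2 \<in> {..<n} \<rightarrow> carrier H
           \<and> comult X u = (\<Oplus>\<^bsub>tensor2 X\<^esub>i \<in> {..<n}. pure2 X (u\<^sub>1 i) (u\<^sub>2 i)) \<longrightarrow>
           bracket L \<delta> \<delta>' u =
             (\<Oplus>\<^bsub>K\<^esub>i \<in> {..<n}. \<delta> (u\<^sub>1 i) \<otimes>\<^bsub>K\<^esub> \<delta>' (u\<^sub>2 i) \<ominus>\<^bsub>K\<^esub> \<delta>' (u\<^sub>1 i) \<otimes>\<^bsub>K\<^esub> \<delta> (u\<^sub>2 i)))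
    \<and> lie_algebra K L'
    \<and> (\<exists>\<phi> \<in> lie_isos K L L'. \<forall>\<delta> \<in> carrier L. \<forall>u \<in> carrier H. \<phi> \<delta> (el \<one>\<^bsub>K\<^esub> u \<one>\<^bsub>K\<^esub>) = \<delta> u)"
    using isotropy_lie_algebra bracket_sweedler by blast
qed

end
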